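(* Let $X$ be a quasi-compact quasi-separated scheme, let $R=\mathscr{O}_X(X)$ and let $f:X\to\operatorname{Spec}(R)$ be the canonical morphism. Then the connected components of $X$ are exactly the subsets of the form $f^{-1}(C)$ where $C$ is a connected component of $\operatorname{Spec}(R)$ (i.e. $f^{-1}(C)$ is a connected component of $X$ for each connected component $C$ of $\operatorname{Spec}(R)$, and every connected component of $X$ arises in this way). In particular, there is a natural homeomorphism $\pi_0(X)\simeq\pi_0(\operatorname{Spec}(R))$ (the map induced by $f$).
   Context: For a topological space $Y$, $\pi_0(Y)$ denotes the set of connected components of $Y$ equipped with the quotient topology from $Y$. The canonical morphism $f:X\to\operatorname{Spec}(\mathscr{O}_X(X))$ is, on underlying spaces, $f(x)=$ the preimage of the maximal ideal $\mathfrak m_x$ of $\mathscr{O}_{X,x}$ under the natural ring map $\mathscr{O}_X(X)\to\mathscr{O}_{X,x}$. Connected spaces are nonempty by convention. *)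

theory Defs
  imports "HOL-Analysis.Abstract_Topological_Spaces" "HOL-Algebra.QuotRing"
begin

section \<open>Ringed spaces\<close>

text \<open>Only the values of \<open>sect\<close> on open sets, and of \<open>restr\<close> on pairs of open sets
  \<open>V \<subseteq> U\<close>, are meaningful; \<open>restr X U V\<close> maps \<open>sect X U\<close> to \<open>sect X V\<close>.\<close>

record ('a, 'b) ringed_space_data =
  top_of :: "'a topology"
  sect :: "'a set \<Rightarrow> 'b ring"
  restr :: "'a set \<Rightarrow> 'a set \<Rightarrow> 'b \<Rightarrow> 'b"

locale ringed_space =
  fixes X :: "('a, 'b) ringed_space_data"
  assumes cring_sect: "openin (top_of X) U \<Longrightarrow> cring (sect X U)"
    and restr_hom: "\<lbrakk>openin (top_of X) U; openin (top_of X) V; V \<subseteq> U\<rbrakk>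
      \<Longrightarrow> restr X U V \<in> ring_hom (sect X U) (sect X V)"
    and restr_id: "\<lbrakk>openin (top_of X) U; s \<in> carrier (sect X U)\<rbrakk> \<Longrightarrow> restr X U U s = s"
    and restr_comp: "\<lbrakk>openin (top_of X) U; openin (top_of X) V; openin (top_of X) W;
        W \<subseteq> V; V \<subseteq> U; s \<in> carrier (sect X U)\<rbrakk>
      \<Longrightarrow> restr X V W (restr X U V s) = restr X U W s"
    and glue: "\<lbrakk>\<And>U. U \<in> \<U> \<Longrightarrow> openin (top_of X) U;
        \<And>U. U \<in> \<U> \<Longrightarrow> \<sigma> U \<in> carrier (sect X U);
        \<And>U V. \<lbrakk>U \<in> \<U>; V \<in> \<U>\<rbrakk> \<Longrightarrow> restr X U (U \<inter> V) (\<sigma> U) = restr X V (U \<inter> V) (\<sigma> V)\<rbrakk>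
      \<Longrightarrow> \<exists>!t. t \<in> carrier (sect X (\<Union>\<U>)) \<and> (\<forall>U\<in>\<U>. restr X (\<Union>\<U>) U t = \<sigma> U)"

definition global_sections :: "('a, 'b) ringed_space_data \<Rightarrow> 'b ring" where
  "global_sections X = sect X (topspace (top_of X))"

definition open_subspace :: "('a, 'b) ringed_space_data \<Rightarrow> 'a set \<Rightarrow> ('a, 'b) ringed_space_data" where
  "open_subspace X U = X\<lparr>top_of := subtopology (top_of X) U\<rparr>"

text \<open>The map on sections goes from \<open>Y\<close> to \<open>X\<close>: \<open>\<psi> V\<close> is the ring isomorphism from \<open>sect Y V\<close> to
  the sections of \<open>X\<close> over the preimage of \<open>V\<close>. Such an isomorphism induces isomorphisms on all
  stalks, so between locally ringed spaces it is automatically an isomorphism of locally ringed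
  spaces.\<close>

definition ringed_space_iso ::
    "('a, 'b) ringed_space_data \<Rightarrow> ('c, 'd) ringed_space_data
      \<Rightarrow> ('a \<Rightarrow> 'c) \<Rightarrow> ('c set \<Rightarrow> 'd \<Rightarrow> 'b) \<Rightarrow> bool" where
  "ringed_space_iso X Y \<phi> \<psi> \<longleftrightarrow>
    (let pre = (\<lambda>V. {x \<in> topspace (top_of X). \<phi> x \<in> V}) in
      homeomorphic_map (top_of X) (top_of Y) \<phi> \<and>
      (\<forall>V. openin (top_of Y) V \<longrightarrow> \<psi> V \<in> ring_iso (sect Y V) (sect X (pre V))) \<and>
      (\<forall>V W. openin (top_of Y) V \<and> openin (top_of Y) W \<and> W \<subseteq> V \<longrightarrow>
        (\<forall>s\<in>carrier (sect Y V). \<psi> W (restr Y V W s) = restr X (pre V) (pre W) (\<psi> V s))))"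

section \<open>Stalks and locally ringed spaces\<close>

definition local_sections :: "('a, 'b) ringed_space_data \<Rightarrow> 'a \<Rightarrow> ('a set \<times> 'b) set" where
  "local_sections X x = {(U, s). openin (top_of X) U \<and> x \<in> U \<and> s \<in> carrier (sect X U)}"

definition germ_rel ::
    "('a, 'b) ringed_space_data \<Rightarrow> 'a \<Rightarrow> (('a set \<times> 'b) \<times> ('a set \<times> 'b)) set" where
  "germ_rel X x = {((U, s), (V, t)). (U, s) \<in> local_sections X x \<and> (V, t) \<in> local_sections X x \<and>
    (\<exists>W. openin (top_of X) W \<and> x \<in> W \<and> W \<subseteq> U \<inter> V \<and> restr X U W s = restr X V W t)}"

definition germ :: "('a, 'b) ringed_space_data \<Rightarrow> 'a \<Rightarrow> 'a set \<Rightarrow> 'b \<Rightarrow> ('a set \<times> 'b) set" where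
  "germ X x U s = germ_rel X x `` {(U, s)}"

text \<open>In the two operations the sets being united all coincide, because the germ of the result does
  not depend on the chosen representatives.\<close>

definition stalk :: "('a, 'b) ringed_space_data \<Rightarrow> 'a \<Rightarrow> ('a set \<times> 'b) set ring" where
  "stalk X x =
    \<lparr>carrier = local_sections X x // germ_rel X x,
     mult = (\<lambda>a b. \<Union>(U, s)\<in>a. \<Union>(V, t)\<in>b.
       germ X x (U \<inter> V) (restr X U (U \<inter> V) s \<otimes>\<^bsub>sect X (U \<inter> V)\<^esub> restr X V (U \<inter> V) t)),
     one = germ X x (topspace (top_of X)) \<one>\<^bsub>global_sections X\<^esub>,
     zero = germ X x (topspace (top_of X)) \<zero>\<^bsub>global_sections X\<^esub>,
     add = (\<lambda>a b. \<Union>(U, s)\<in>a. \<Union>(V, t)\<in>b.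
       germ X x (U \<inter> V) (restr X U (U \<inter> V) s \<oplus>\<^bsub>sect X (U \<inter> V)\<^esub> restr X V (U \<inter> V) t))\<rparr>"

definition local_ring :: "('a, 'm) ring_scheme \<Rightarrow> bool" where
  "local_ring R \<longleftrightarrow> cring R \<and> (\<exists>!I. maximalideal I R)"

definition the_maximal_ideal :: "('a, 'm) ring_scheme \<Rightarrow> 'a set" where
  "the_maximal_ideal R = (THE I. maximalideal I R)"

locale locally_ringed_space = ringed_space X for X :: "('a, 'b) ringed_space_data" +
  assumes local_stalk: "x \<in> topspace (top_of X) \<Longrightarrow> local_ring (stalk X x)"

section \<open>The spectrum of a commutative ring\<close>

definition primes :: "('a, 'm) ring_scheme \<Rightarrow> 'a set set" where
  "primes A = {p. primeideal p A}"

definition zariski_open :: "('a, 'm) ring_scheme \<Rightarrow> 'a set set \<Rightarrow> bool" where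
  "zariski_open A U \<longleftrightarrow> (\<exists>E\<subseteq>carrier A. U = primes A - {p \<in> primes A. E \<subseteq> p})"

definition zariski_topology :: "('a, 'm) ring_scheme \<Rightarrow> 'a set topology" where
  "zariski_topology A = topology (zariski_open A)"

lemma istopology_zariski_open: "istopology (zariski_open A)"
  unfolding istopology_def
proof (intro conjI allI impI)
  fix U V assume "zariski_open A U" "zariski_open A V"
  then obtain E F where E: "E \<subseteq> carrier A" "U = primes A - {p \<in> primes A. E \<subseteq> p}"
    and F: "F \<subseteq> carrier A" "V = primes A - {p \<in> primes A. F \<subseteq> p}"
    unfolding zariski_open_def by blast
  define G where "G = {e \<otimes>\<^bsub>A\<^esub> f | e f. e \<in> E \<and> f \<in> F}"
  have *: "G \<subseteq> p \<longleftrightarrow> E \<subseteq> p \<or> F \<subseteq> p" if "p \<in> primes A" for p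
  proof -
    interpret primeideal p A using that by (simp add: primes_def)
    show ?thesis
    proof
      assume G: "G \<subseteq> p"
      show "E \<subseteq> p \<or> F \<subseteq> p"
      proof (rule ccontr)
        assume "\<not> (E \<subseteq> p \<or> F \<subseteq> p)"
        then obtain e f where ef: "e \<in> E" "e \<notin> p" "f \<in> F" "f \<notin> p" by blast
        then have "e \<otimes>\<^bsub>A\<^esub> f \<in> p" using G unfolding G_def by blast
        then show False using I_prime[of e f] ef E(1) F(1) by blast
      qed
    next
      assume "E \<subseteq> p \<or> F \<subseteq> p"
      then show "G \<subseteq> p"
        using E(1) F(1) I_l_closed I_r_closed unfolding G_def by blast
    qed
  qed
  have "G \<subseteq> carrier A" if "p \<in> primes A" for p
  proof -
    interpret primeideal p A using that by (simp add: primes_def)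
    show ?thesis using E(1) F(1) unfolding G_def by blast
  qed
  note G = this
  have UV: "U \<inter> V = primes A - {p \<in> primes A. G \<subseteq> p}"
    using * E(2) F(2) by blast
  show "zariski_open A (U \<inter> V)"
  proof (cases "primes A = {}")
    case True
    then have "U \<inter> V = primes A - {p \<in> primes A. {} \<subseteq> p}" using UV by simp
    then show ?thesis unfolding zariski_open_def by blast
  next
    case False
    then have "G \<subseteq> carrier A" using G by (meson ex_in_conv)
    then show ?thesis unfolding zariski_open_def using UV by (intro exI[of _ G] conjI)
  qed
next
  fix \<K> assume K: "\<forall>K\<in>\<K>. zariski_open A K"
  define F where "F = \<Union>{E. E \<subseteq> carrier A \<and> primes A - {p \<in> primes A. E \<subseteq> p} \<in> \<K>}"
  have "\<Union>\<K> = primes A - {p \<in> primes A. F \<subseteq> p}"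
  proof (intro equalityI subsetI)
    fix p assume "p \<in> \<Union>\<K>"
    then obtain K where pK: "K \<in> \<K>" "p \<in> K" by (rule UnionE)
    then have "zariski_open A K" using K by (intro bspec[of \<K> "zariski_open A"])
    then obtain E where E: "E \<subseteq> carrier A" "K = primes A - {p \<in> primes A. E \<subseteq> p}"
      unfolding zariski_open_def by (elim exE conjE)
    have "E \<subseteq> F" using E pK(1) unfolding F_def by blast
    then show "p \<in> primes A - {p \<in> primes A. F \<subseteq> p}" using pK(2) E(2) by auto
  next
    fix p assume p: "p \<in> primes A - {p \<in> primes A. F \<subseteq> p}"
    then obtain e where "e \<in> F" "e \<notin> p" by blast
    then obtain E where "e \<in> E" "primes A - {p \<in> primes A. E \<subseteq> p} \<in> \<K>"
      unfolding F_def by blast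
    moreover have "p \<in> primes A - {p \<in> primes A. E \<subseteq> p}"
      using p \<open>e \<in> E\<close> \<open>e \<notin> p\<close> by blast
    ultimately show "p \<in> \<Union>\<K>" by blast
  qed
  moreover have "F \<subseteq> carrier A" unfolding F_def by blast
  ultimately show "zariski_open A (\<Union>\<K>)"
    unfolding zariski_open_def by (intro exI[of _ F] conjI)
qed

lemma openin_zariski_topology: "openin (zariski_topology A) U \<longleftrightarrow> zariski_open A U"
  by (simp add: zariski_topology_def istopology_zariski_open topology_inverse')

lemma topspace_zariski_topology: "topspace (zariski_topology A) = primes A"
proof
  show "topspace (zariski_topology A) \<subseteq> primes A"
    by (auto simp: topspace_def openin_zariski_topology zariski_open_def)
  have "zariski_open A (primes A)"
  proof (cases "primes A = {}")
    case True
    then show ?thesis unfolding zariski_open_def by blast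
  next
    case False
    have "primes A - {p \<in> primes A. carrier A \<subseteq> p} = primes A"
    proof -
      have "\<not> carrier A \<subseteq> p" if "p \<in> primes A" for p
      proof -
        interpret primeideal p A using that by (simp add: primes_def)
        show ?thesis using I_notcarr a_subset by blast
      qed
      then show ?thesis by blast
    qed
    then show ?thesis unfolding zariski_open_def by blast
  qed
  then show "primes A \<subseteq> topspace (zariski_topology A)"
    by (simp add: openin_subset openin_zariski_topology)
qed

text \<open>Localization of \<open>A\<close> at a multiplicative set \<open>S\<close>: \<open>a/s = b/t\<close> iff \<open>u(at - bs) = 0\<close> for some
  \<open>u \<in> S\<close>. As for stalks, the sets united in the operations all coincide.\<close>

definition frac_rel :: "('a, 'm) ring_scheme \<Rightarrow> 'a set \<Rightarrow> (('a \<times> 'a) \<times> ('a \<times> 'a)) set" where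
  "frac_rel A S = {((a, s), (b, t)). a \<in> carrier A \<and> s \<in> S \<and> b \<in> carrier A \<and> t \<in> S \<and>
    (\<exists>u\<in>S. u \<otimes>\<^bsub>A\<^esub> (a \<otimes>\<^bsub>A\<^esub> t \<ominus>\<^bsub>A\<^esub> b \<otimes>\<^bsub>A\<^esub> s) = \<zero>\<^bsub>A\<^esub>)}"

definition frac :: "('a, 'm) ring_scheme \<Rightarrow> 'a set \<Rightarrow> 'a \<Rightarrow> 'a \<Rightarrow> ('a \<times> 'a) set" where
  "frac A S a s = frac_rel A S `` {(a, s)}"

definition localization :: "('a, 'm) ring_scheme \<Rightarrow> 'a set \<Rightarrow> ('a \<times> 'a) set ring" where
  "localization A S =
    \<lparr>carrier = (carrier A \<times> S) // frac_rel A S,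
     mult = (\<lambda>x y. \<Union>(a, s)\<in>x. \<Union>(b, t)\<in>y. frac A S (a \<otimes>\<^bsub>A\<^esub> b) (s \<otimes>\<^bsub>A\<^esub> t)),
     one = frac A S \<one>\<^bsub>A\<^esub> \<one>\<^bsub>A\<^esub>,
     zero = frac A S \<zero>\<^bsub>A\<^esub> \<one>\<^bsub>A\<^esub>,
     add = (\<lambda>x y. \<Union>(a, s)\<in>x. \<Union>(b, t)\<in>y.
       frac A S (a \<otimes>\<^bsub>A\<^esub> t \<oplus>\<^bsub>A\<^esub> b \<otimes>\<^bsub>A\<^esub> s) (s \<otimes>\<^bsub>A\<^esub> t))\<rparr>"

abbreviation localization_at :: "('a, 'm) ring_scheme \<Rightarrow> 'a set \<Rightarrow> ('a \<times> 'a) set ring" where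
  "localization_at A p \<equiv> localization A (carrier A - p)"

text \<open>Sections over \<open>U\<close> are the families of elements of the localizations at the points of \<open>U\<close> that
  are locally given by a single fraction. They are extensional functions, so that equality in
  HOL is equality on \<open>U\<close>.\<close>

definition spec_sections :: "('a, 'm) ring_scheme \<Rightarrow> 'a set set \<Rightarrow> ('a set \<Rightarrow> ('a \<times> 'a) set) set" where
  "spec_sections A U = {\<sigma> \<in> (\<Pi>\<^sub>E p\<in>U. carrier (localization_at A p)).
    \<forall>p\<in>U. \<exists>V a f. openin (zariski_topology A) V \<and> p \<in> V \<and> V \<subseteq> U \<and> a \<in> carrier A \<and> f \<in> carrier A \<and>
      (\<forall>q\<in>V. f \<notin> q \<and> \<sigma> q = frac A (carrier A - q) a f)}"

definition Spec :: "('a, 'm) ring_scheme \<Rightarrow> ('a set, 'a set \<Rightarrow> ('a \<times> 'a) set) ringed_space_data" where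
  "Spec A =
    \<lparr>top_of = zariski_topology A,
     sect = (\<lambda>U.
       \<lparr>carrier = spec_sections A U,
        mult = (\<lambda>\<sigma> \<tau>. \<lambda>p\<in>U. \<sigma> p \<otimes>\<^bsub>localization_at A p\<^esub> \<tau> p),
        one = (\<lambda>p\<in>U. \<one>\<^bsub>localization_at A p\<^esub>),
        zero = (\<lambda>p\<in>U. \<zero>\<^bsub>localization_at A p\<^esub>),
        add = (\<lambda>\<sigma> \<tau>. \<lambda>p\<in>U. \<sigma> p \<oplus>\<^bsub>localization_at A p\<^esub> \<tau> p)\<rparr>),
     restr = (\<lambda>U V \<sigma>. restrict \<sigma> V)\<rparr>"

section \<open>Schemes\<close>

text \<open>Up to isomorphism the only possible coordinate ring of an affine open \<open>U\<close> is the ring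
  \<open>sect X U\<close>, whose elements have type \<open>'b\<close>. Hence letting the coordinate rings range over the rings
  with elements of type \<open>'b\<close> is no restriction.\<close>

locale scheme = locally_ringed_space X for X :: "('a, 'b) ringed_space_data" +
  assumes locally_affine: "x \<in> topspace (top_of X) \<Longrightarrow>
    \<exists>U (A :: 'b ring) \<phi> \<psi>. openin (top_of X) U \<and> x \<in> U \<and> cring A \<and>
      ringed_space_iso (open_subspace X U) (Spec A) \<phi> \<psi>"

definition quasi_compact :: "('a, 'b) ringed_space_data \<Rightarrow> bool" where
  "quasi_compact X \<longleftrightarrow> compact_space (top_of X)"

text \<open>Quasi-separatedness is taken in its topological form, as a property of the underlying space
  (Vakil's definition); for schemes it amounts to quasi-compactness of the diagonal.\<close>

definition quasi_separated :: "('a, 'b) ringed_space_data \<Rightarrow> bool" where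
  "quasi_separated X \<longleftrightarrow>
    (\<forall>U V. openin (top_of X) U \<and> compactin (top_of X) U \<and> openin (top_of X) V \<and> compactin (top_of X) V
      \<longrightarrow> compactin (top_of X) (U \<inter> V))"

text \<open>The underlying map of the canonical morphism from \<open>X\<close> to the spectrum of its ring of global
  sections.\<close>

definition canonical_map :: "('a, 'b) ringed_space_data \<Rightarrow> 'a \<Rightarrow> 'b set" where
  "canonical_map X x = {s \<in> carrier (global_sections X).
    germ X x (topspace (top_of X)) s \<in> the_maximal_ideal (stalk X x)}"

section \<open>The space of connected components\<close>

definition pi0 :: "'a topology \<Rightarrow> 'a set topology" where
  "pi0 Y = topology (\<lambda>\<C>. \<C> \<subseteq> connected_components_of Y \<and>
    openin Y {y \<in> topspace Y. connected_component_of_set Y y \<in> \<C>})"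

lemma openin_pi0:
  "openin (pi0 Y) \<C> \<longleftrightarrow> \<C> \<subseteq> connected_components_of Y \<and>
    openin Y {y \<in> topspace Y. connected_component_of_set Y y \<in> \<C>}"
proof -
  have "istopology (\<lambda>\<C>. \<C> \<subseteq> connected_components_of Y \<and>
    openin Y {y \<in> topspace Y. connected_component_of_set Y y \<in> \<C>})" (is "istopology ?P")
    unfolding istopology_def
  proof (intro conjI allI impI; (elim conjE)?)
    fix S T assume "openin Y {y \<in> topspace Y. connected_component_of_set Y y \<in> S}"
      "openin Y {y \<in> topspace Y. connected_component_of_set Y y \<in> T}"
    then have "openin Y ({y \<in> topspace Y. connected_component_of_set Y y \<in> S} \<inter>
        {y \<in> topspace Y. connected_component_of_set Y y \<in> T})"
      by (rule openin_Int)
    then show "openin Y {y \<in> topspace Y. connected_component_of_set Y y \<in> S \<inter> T}"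
      by (rule back_subst[where P = "openin Y"]) blast
  next
    fix \<K> assume K: "\<forall>K\<in>\<K>. ?P K"
    then have "openin Y (\<Union>K\<in>\<K>. {y \<in> topspace Y. connected_component_of_set Y y \<in> K})" by blast
    then show "openin Y {y \<in> topspace Y. connected_component_of_set Y y \<in> \<Union>\<K>}"
      by (rule back_subst[where P = "openin Y"]) blast
  qed blast+
  then show ?thesis by (simp add: pi0_def topology_inverse')
qed

lemma quotient_map_pi0: "quotient_map Y (pi0 Y) (connected_component_of_set Y)"
proof -
  have "openin (pi0 Y) (connected_components_of Y)"
    by (simp add: openin_pi0 connected_component_in_connected_components_of)
  then have "topspace (pi0 Y) = connected_components_of Y"
    by (metis openin_pi0 openin_subset openin_topspace subset_antisym)
  then show ?thesis
    by (auto simp: quotient_map_def openin_pi0 connected_components_of_def)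
qed

end

theory Submission
  imports Defs "HOL-Algebra.Ring_Divisibility"
begin

text \<open>In a quasi-compact space with a base of quasi-compact open sets closed under binary
  intersection, the connected component of a point is the intersection of the clopen sets containing
  it; this applies to \<open>X\<close> and to \<open>Spec(R)\<close>. Clopen subsets of either space are the non-vanishing
  loci of idempotents of \<open>R\<close>, and \<open>f\<close> matches the two loci of an idempotent. A nonzero
  idempotent has nonempty locus in \<open>X\<close>, so by quasi-compactness \<open>f\<close> meets every component of
  \<open>Spec(R)\<close>, and the preimage of a component is the intersection of all clopen sets around a
  point of \<open>X\<close>.\<close>

section \<open>Components and clopen sets\<close>

text \<open>The canonical map need not be surjective: for the affine plane over a field with the
  origin removed, it misses the origin. It is therefore compared with the spectrum through clopen
  sets alone, and the topology on components is recovered from these by compactness. Idempotents can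
  do this work because the stalks are local: an idempotent section whose germ lies in the maximal
  ideal at a point has zero germ there, so it vanishes on a whole neighbourhood. The other obstacle
  is that these spaces are rarely Hausdorff, so two disjoint closed pieces of a quasi-component
  cannot be separated by disjoint open sets. Quasi-separatedness repairs this: the overlap of two
  quasi-compact open neighbourhoods is still quasi-compact, and a clopen set can be chosen to avoid
  it.\<close>

lemma clopen_avoiding_compact:
  assumes "compactin X K" "x \<in> topspace X" "K \<inter> quasi_component_of_set X x = {}"
  obtains W where "openin X W" "closedin X W" "x \<in> W" "W \<inter> K = {}"
proof -
  define \<W> where "\<W> = {W. closedin X W \<and> openin X W \<and> x \<in> W}"
  have K: "K \<subseteq> topspace X" using assms(1) by (simp add: compactin_subset_topspace)
  have "K \<inter> \<Inter>\<W> = {}"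
    using assms(2,3) by (simp add: \<W>_def quasi_component_of_set)
  moreover have "\<forall>C\<in>\<W>. closedin X C" by (simp add: \<W>_def)
  ultimately obtain \<F> where \<F>: "finite \<F>" "\<F> \<subseteq> \<W>" "K \<inter> \<Inter>\<F> = {}"
    using assms(1) unfolding compactin_fip by blast
  \<comment> \<open>Intersecting with \<open>topspace X\<close> covers the case of an empty family,
    whose intersection is the whole type.\<close>
  have "openin X (topspace X \<inter> \<Inter>\<F>)"
    using \<F>(1,2) by (cases "\<F> = {}") (auto simp: \<W>_def intro!: openin_Int openin_Inter)
  moreover have "closedin X (topspace X \<inter> \<Inter>\<F>)"
    using \<F>(1,2) by (cases "\<F> = {}") (auto simp: \<W>_def intro!: closedin_Int closedin_Inter)
  moreover have "x \<in> topspace X \<inter> \<Inter>\<F>" using \<F>(2) assms(2) by (auto simp: \<W>_def)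
  ultimately show thesis using that \<F>(3) by blast
qed

lemma clopen_within_open:
  assumes "compact_space X" "openin X U" "x \<in> topspace X" "quasi_component_of_set X x \<subseteq> U"
  obtains W where "openin X W" "closedin X W" "x \<in> W" "W \<subseteq> U"
proof -
  have "compactin X (topspace X - U)"
    using assms(1,2) by (blast intro: closedin_compact_space)
  then obtain W where "openin X W" "closedin X W" "x \<in> W" "W \<inter> (topspace X - U) = {}"
    using assms(3,4) by (elim clopen_avoiding_compact[where x = x]) auto
  then show thesis using that openin_subset[of X W] by blast
qed

text \<open>Finitely many members of the base inside \<open>U\<close> already cover
  \<open>C\<close>, and their union is again compact. The lemma stands in for the separation
  properties of Hausdorff spaces.\<close>

lemma compactin_within_open:
  assumes base: "\<And>U x. \<lbrakk>openin X U; x \<in> U\<rbrakk> \<Longrightarrow> \<exists>K. openin X K \<and> compactin X K \<and> x \<in> K \<and> K \<subseteq> U"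
    and "compactin X C" "openin X U" "C \<subseteq> U"
  obtains K where "openin X K" "compactin X K" "C \<subseteq> K" "K \<subseteq> U"
proof -
  define \<K> where "\<K> = {K. openin X K \<and> compactin X K \<and> K \<subseteq> U}"
  have "C \<subseteq> \<Union>\<K>" using base[OF assms(3)] assms(4) by (fastforce simp: \<K>_def)
  moreover have "\<forall>K\<in>\<K>. openin X K" by (simp add: \<K>_def)
  ultimately obtain \<F> where "finite \<F>" "\<F> \<subseteq> \<K>" "C \<subseteq> \<Union>\<F>"
    using assms(2) unfolding compactin_def by metis
  moreover from this have "compactin X (\<Union>\<F>)" by (auto simp: \<K>_def intro!: compactin_Union)
  ultimately show thesis by (intro that[of "\<Union>\<F>"]) (auto simp: \<K>_def)
qed

text \<open>It suffices that the quasi-component is connected. If it split into disjoint closed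
  pieces, put each into a compact open set that misses the other piece. The overlap of these two
  sets is compact and misses the quasi-component, so shrinking to a clopen set around
  \<open>x\<close> removes it, and what remains yields a clopen set that cuts the
  quasi-component.\<close>

lemma quasi_eq_connected_component_of_compact_base:
  assumes compact: "compact_space X"
    and base: "\<And>U x. \<lbrakk>openin X U; x \<in> U\<rbrakk> \<Longrightarrow> \<exists>K. openin X K \<and> compactin X K \<and> x \<in> K \<and> K \<subseteq> U"
    and inter: "\<And>U V. \<lbrakk>openin X U; compactin X U; openin X V; compactin X V\<rbrakk> \<Longrightarrow> compactin X (U \<inter> V)"
  shows "quasi_component_of X x = connected_component_of X x"
proof (cases "x \<in> topspace X")
  case False
  then show ?thesis
    by (metis connectedin_empty quasi_component_of_eq_empty quasi_eq_connected_component_of_eq)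
next
  case True
  let ?S = "quasi_component_of_set X x"
  have closed: "closedin X ?S" by (rule closedin_quasi_component_of)
  have impossible: False
    if "closedin X B" "closedin X C" "?S = B \<union> C" "B \<inter> C = {}" "x \<in> B" "C \<noteq> {}" for B C
  proof -
    have "compactin X B" "compactin X C" using compact that by (auto intro: closedin_compact_space)
    moreover have "B \<subseteq> topspace X - C" "C \<subseteq> topspace X - B"
      using that closedin_subset by fastforce+
    moreover have "openin X (topspace X - C)" "openin X (topspace X - B)"
      using that by auto
    ultimately obtain U V where U: "openin X U" "compactin X U" "B \<subseteq> U" "U \<subseteq> topspace X - C"
      and V: "openin X V" "compactin X V" "C \<subseteq> V" "V \<subseteq> topspace X - B"
      using compactin_within_open[OF base] by metis
    have "(U \<inter> V) \<inter> ?S = {}" using U V that by blast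
    then obtain W where W: "openin X W" "closedin X W" "x \<in> W" "W \<inter> (U \<inter> V) = {}"
      using clopen_avoiding_compact[OF inter[OF U(1,2) V(1,2)] True] by metis
    have "?S \<subseteq> U \<union> V" using U V that by blast
    then obtain W' where W': "openin X W'" "closedin X W'" "x \<in> W'" "W' \<subseteq> U \<union> V"
      using clopen_within_open[OF compact openin_Un[OF U(1) V(1)] True] by metis
    \<comment> \<open>Within \<open>W \<inter> W'\<close> the sets \<open>U\<close> and
      \<open>V\<close> are complementary: they cover \<open>W'\<close>, and \<open>W\<close> avoids
      their overlap. So the part in \<open>U\<close> is closed as well as open.\<close>
    have eq: "W \<inter> W' \<inter> U = (W \<inter> W') \<inter> (topspace X - V)"
      using W W' U openin_subset by blast
    have "openin X (W \<inter> W' \<inter> U)" using W W' U by blast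
    moreover have "closedin X (W \<inter> W' \<inter> U)" unfolding eq using W W' V by blast
    moreover have "x \<in> W \<inter> W' \<inter> U" using W W' U that by blast
    ultimately have "?S \<subseteq> W \<inter> W' \<inter> U" using True by (auto simp: quasi_component_of_set)
    then show False using that U(4) by blast
  qed
  have "connectedin X ?S"
  proof (rule ccontr)
    assume "\<not> connectedin X ?S"
    then obtain E F where EF: "closedin X E" "closedin X F" "?S \<subseteq> E \<union> F" "E \<inter> F \<inter> ?S = {}"
      "E \<inter> ?S \<noteq> {}" "F \<inter> ?S \<noteq> {}"
      unfolding connectedin_closedin using quasi_component_of_subset_topspace by metis
    have "closedin X (E \<inter> ?S)" "closedin X (F \<inter> ?S)" using EF closed by blast+
    moreover have "x \<in> ?S" using True by simp
    ultimately show False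
      using impossible[of "E \<inter> ?S" "F \<inter> ?S"] impossible[of "F \<inter> ?S" "E \<inter> ?S"] EF by blast
  qed
  then show ?thesis by (simp add: quasi_eq_connected_component_of_eq)
qed

section \<open>Maps that match the clopen sets of two compact spaces\<close>

lemma quasi_component_of_clopen_iff:
  "\<lbrakk>quasi_component_of X x y; openin X T; closedin X T\<rbrakk> \<Longrightarrow> x \<in> T \<longleftrightarrow> y \<in> T"
  by (simp add: quasi_component_of_def)

lemma connected_component_of_set_eq:
  "connected_component_of X x y \<Longrightarrow> connected_component_of_set X x = connected_component_of_set X y"
  by (metis connected_component_of_equiv)

lemma topspace_pi0: "topspace (pi0 Y) = connected_components_of Y"
  using quotient_map_pi0[of Y] by (simp add: quotient_map_def connected_components_of_def)

text \<open>The conditions on \<open>f\<close> concern clopen sets only, since these are what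
  idempotents control. \<open>vimage_nonempty\<close> is a weak form of surjectivity that suffices
  to reach every component.\<close>

locale clopen_correspondence =
  fixes X :: "'a topology" and Y :: "'b topology" and f :: "'a \<Rightarrow> 'b"
  assumes compact_dom: "compact_space X" and compact_cod: "compact_space Y"
    and quasi_dom: "\<And>x. quasi_component_of X x = connected_component_of X x"
    and quasi_cod: "\<And>y. quasi_component_of Y y = connected_component_of Y y"
    and maps: "x \<in> topspace X \<Longrightarrow> f x \<in> topspace Y"
    and open_vimage: "\<lbrakk>openin Y W; closedin Y W\<rbrakk> \<Longrightarrow> openin X {x \<in> topspace X. f x \<in> W}"
    and vimage_nonempty: "\<lbrakk>openin Y W; closedin Y W; W \<noteq> {}\<rbrakk> \<Longrightarrow> \<exists>x\<in>topspace X. f x \<in> W"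
    and clopen_lift: "\<lbrakk>openin X Z; closedin X Z\<rbrakk>
      \<Longrightarrow> \<exists>W. openin Y W \<and> closedin Y W \<and> Z = {x \<in> topspace X. f x \<in> W}"
begin

lemma closed_vimage:
  assumes "openin Y W" "closedin Y W"
  shows "closedin X {x \<in> topspace X. f x \<in> W}"
proof -
  have "openin X {x \<in> topspace X. f x \<in> topspace Y - W}"
    using assms by (intro open_vimage) auto
  moreover have "{x \<in> topspace X. f x \<in> topspace Y - W} = topspace X - {x \<in> topspace X. f x \<in> W}"
    using maps by blast
  ultimately show ?thesis by (simp add: closedin_def)
qed

text \<open>On both sides components are quasi-components, so only membership in clopen sets has to
  be compared. Clopen sets of \<open>Y\<close> pull back to clopen sets of \<open>X\<close>, and by
  \<open>clopen_lift\<close> every clopen set of \<open>X\<close> arises in this way.\<close>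

lemma connected_component_iff:
  assumes "x \<in> topspace X" "x' \<in> topspace X"
  shows "connected_component_of Y (f x) (f x') \<longleftrightarrow> connected_component_of X x x'"
  unfolding quasi_dom[symmetric] quasi_cod[symmetric]
proof
  assume "quasi_component_of Y (f x) (f x')"
  moreover have "x' \<in> Z"
    if "quasi_component_of Y (f x) (f x')" "closedin X Z" "openin X Z" "x \<in> Z" for Z
    using clopen_lift[OF that(3,2)] that assms unfolding quasi_component_of by blast
  ultimately show "quasi_component_of X x x'" using assms unfolding quasi_component_of by blast
next
  assume L: "quasi_component_of X x x'"
  have "f x' \<in> W" if "closedin Y W" "openin Y W" "f x \<in> W" for W
  proof -
    have "openin X {x \<in> topspace X. f x \<in> W}" "closedin X {x \<in> topspace X. f x \<in> W}"
      using open_vimage closed_vimage that by blast+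
    then have "x \<in> {x \<in> topspace X. f x \<in> W} \<longleftrightarrow> x' \<in> {x \<in> topspace X. f x \<in> W}"
      by (rule quasi_component_of_clopen_iff[OF L])
    then show ?thesis using that(3) assms(1) by simp
  qed
  then show "quasi_component_of Y (f x) (f x')"
    using assms maps unfolding quasi_component_of by blast
qed

text \<open>The preimages of the clopen neighbourhoods of \<open>y\<close> are closed, and they have
  the finite intersection property because a finite intersection of such neighbourhoods is again
  one. A common point of all of them maps into the quasi-component of \<open>y\<close>.\<close>

lemma meets_component:
  assumes "y \<in> topspace Y"
  obtains x where "x \<in> topspace X" "connected_component_of Y y (f x)"
proof -
  define \<W> where "\<W> = {W. openin Y W \<and> closedin Y W \<and> y \<in> W}"
  define v where "v = (\<lambda>W. {x \<in> topspace X. f x \<in> W})"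
  have "topspace Y \<in> \<W>" using assms by (auto simp: \<W>_def)
  then have ne: "\<W> \<noteq> {}" by blast
  have "\<Inter>\<F> \<noteq> {}" if \<F>: "finite \<F>" "\<F> \<subseteq> v ` \<W>" for \<F>
  proof -
    obtain \<G> where \<G>: "finite \<G>" "\<G> \<subseteq> \<W>" "\<F> = v ` \<G>" using \<F> by (meson finite_subset_image)
    have "openin Y (topspace Y \<inter> \<Inter>\<G>)"
      using \<G> by (cases "\<G> = {}") (auto simp: \<W>_def intro!: openin_Int openin_Inter)
    moreover have "closedin Y (topspace Y \<inter> \<Inter>\<G>)"
      using \<G> by (cases "\<G> = {}") (auto simp: \<W>_def intro!: closedin_Int closedin_Inter)
    moreover have "y \<in> topspace Y \<inter> \<Inter>\<G>" using \<G>(2) assms by (auto simp: \<W>_def)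
    ultimately obtain x where "x \<in> topspace X" "f x \<in> topspace Y \<inter> \<Inter>\<G>"
      using vimage_nonempty by blast
    then have "x \<in> \<Inter>\<F>" using \<G>(3) by (auto simp: v_def)
    then show ?thesis by blast
  qed
  moreover have "\<forall>C\<in>v ` \<W>. closedin X C" by (auto simp: v_def \<W>_def closed_vimage)
  ultimately have "\<Inter>(v ` \<W>) \<noteq> {}" using compact_dom unfolding compact_space_fip by metis
  then obtain x where x: "\<And>W. W \<in> \<W> \<Longrightarrow> x \<in> topspace X \<and> f x \<in> W" by (auto simp: v_def)
  then have "x \<in> topspace X" using ne by blast
  moreover have "quasi_component_of Y y (f x)"
    using x \<open>x \<in> topspace X\<close> assms maps by (auto simp: quasi_component_of \<W>_def)
  ultimately show thesis using that quasi_cod by simp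
qed

lemma vimage_component:
  assumes "x \<in> topspace X"
  shows "{x' \<in> topspace X. f x' \<in> connected_component_of_set Y (f x)} = connected_component_of_set X x"
  using connected_component_iff[OF assms] connected_component_in_topspace by fastforce

lemma components_cod: "connected_components_of Y = (\<lambda>x. connected_component_of_set Y (f x)) ` topspace X"
proof -
  have "\<exists>x\<in>topspace X. connected_component_of_set Y y = connected_component_of_set Y (f x)"
    if y: "y \<in> topspace Y" for y
  proof -
    obtain x where "x \<in> topspace X" "connected_component_of Y y (f x)" using y by (rule meets_component)
    then show ?thesis by (intro bexI[of _ x] connected_component_of_set_eq)
  qed
  then show ?thesis using maps unfolding connected_components_of_def by blast
qed

lemma components_dom:
  "connected_components_of X = (\<lambda>C. {x \<in> topspace X. f x \<in> C}) ` connected_components_of Y"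
proof -
  have "(\<lambda>C. {x \<in> topspace X. f x \<in> C}) ` connected_components_of Y =
    (\<lambda>x. {x' \<in> topspace X. f x' \<in> connected_component_of_set Y (f x)}) ` topspace X"
    by (simp add: components_cod image_image)
  also have "\<dots> = connected_component_of_set X ` topspace X"
    by (intro image_cong refl vimage_component)
  finally show ?thesis by (simp add: connected_components_of_def)
qed

text \<open>By compactness an open union of components is a union of clopen sets.\<close>

lemma open_vimage_saturated:
  assumes U: "U \<subseteq> topspace Y" and sat: "\<And>y y'. \<lbrakk>y \<in> U; connected_component_of Y y y'\<rbrakk> \<Longrightarrow> y' \<in> U"
  shows "openin X {x \<in> topspace X. f x \<in> U} \<longleftrightarrow> openin Y U"
proof
  assume L: "openin Y U"
  show "openin X {x \<in> topspace X. f x \<in> U}"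
  proof (subst openin_subopen, clarify)
    fix x assume x: "x \<in> topspace X" "f x \<in> U"
    obtain W where "openin Y W" "closedin Y W" "f x \<in> W" "W \<subseteq> U"
    proof (rule clopen_within_open[OF compact_cod L maps[OF x(1)]])
      show "quasi_component_of_set Y (f x) \<subseteq> U" using sat[OF x(2)] by (auto simp: quasi_cod)
    qed
    then show "\<exists>T. openin X T \<and> x \<in> T \<and> T \<subseteq> {x \<in> topspace X. f x \<in> U}"
      using x(1) open_vimage[of W] by (intro exI[of _ "{x \<in> topspace X. f x \<in> W}"]) auto
  qed
next
  assume R: "openin X {x \<in> topspace X. f x \<in> U}"
  show "openin Y U"
  proof (subst openin_subopen, clarify)
    fix y assume y: "y \<in> U"
    obtain x where x: "x \<in> topspace X" "connected_component_of Y y (f x)"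
      using meets_component y U by blast
    have "quasi_component_of_set X x \<subseteq> {x \<in> topspace X. f x \<in> U}"
    proof clarify
      fix x' assume "quasi_component_of X x x'"
      then have "connected_component_of Y (f x) (f x')" "x' \<in> topspace X"
        using quasi_component_in_topspace connected_component_iff quasi_dom by metis+
      then show "x' \<in> topspace X \<and> f x' \<in> U" using sat y x(2) by metis
    qed
    then obtain Z where Z: "openin X Z" "closedin X Z" "x \<in> Z" "Z \<subseteq> {x \<in> topspace X. f x \<in> U}"
      using clopen_within_open[OF compact_dom R x(1)] by metis
    then obtain W where W: "openin Y W" "closedin Y W" "Z = {x \<in> topspace X. f x \<in> W}"
      using clopen_lift by metis
    have clopen: "a \<in> W \<longleftrightarrow> b \<in> W" if "connected_component_of Y a b" for a b
      using that W(1,2) by (intro quasi_component_of_clopen_iff[of Y]) (simp add: quasi_cod)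
    \<comment> \<open>Only the preimage of \<open>W\<close> is known to map into \<open>U\<close>,
      and \<open>W\<close> may contain points outside the image of \<open>f\<close>. Such a point is
      first moved within its component to some \<open>f x'\<close>; both \<open>W\<close> and
      \<open>U\<close> are unions of components.\<close>
    have "w \<in> U" if w: "w \<in> W" for w
    proof -
      obtain x' where x': "x' \<in> topspace X" "connected_component_of Y w (f x')"
        using meets_component w openin_subset[OF W(1)] by blast
      then have "x' \<in> Z" using W(3) clopen w by blast
      then show ?thesis using Z(4) sat x'(2) connected_component_of_sym by fast
    qed
    moreover have "y \<in> W" using W(3) Z(3) clopen x(2) by blast
    ultimately show "\<exists>T. openin Y T \<and> y \<in> T \<and> T \<subseteq> U" using W(1) by blast
  qed
qed

text \<open>Open sets of \<open>pi0\<close> correspond to open unions of components, so the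
  equivalence in \<open>open_vimage_saturated\<close> says that \<open>g\<close> is a quotient map.
  Being injective as well, it is a homeomorphism.\<close>

lemma pi0_homeomorphism:
  obtains g where "homeomorphic_map (pi0 X) (pi0 Y) g"
    "\<And>x. x \<in> topspace X \<Longrightarrow> g (connected_component_of_set X x) = connected_component_of_set Y (f x)"
proof -
  \<comment> \<open>The chosen representative does not matter, because \<open>f\<close> sends points
    of one component into one component.\<close>
  define g where "g = (\<lambda>K. connected_component_of_set Y (f (SOME x. x \<in> K)))"
  have g: "g (connected_component_of_set X x) = connected_component_of_set Y (f x)"
    if "x \<in> topspace X" for x
  proof -
    have "connected_component_of X x (SOME x'. x' \<in> connected_component_of_set X x)"
      using that by (metis connected_component_of_refl mem_Collect_eq someI)
    then show ?thesis
      unfolding g_def using that connected_component_iff connected_component_of_equiv by metis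
  qed
  have "inj_on g (topspace (pi0 X))"
    unfolding topspace_pi0 connected_components_of_def
  proof (rule inj_onI, clarify)
    fix x x' assume x: "x \<in> topspace X" "x' \<in> topspace X"
      and "g (connected_component_of_set X x) = g (connected_component_of_set X x')"
    then have "connected_component_of_set Y (f x) = connected_component_of_set Y (f x')"
      by (simp only: g)
    then show "connected_component_of_set X x = connected_component_of_set X x'"
      using vimage_component[OF x(1)] vimage_component[OF x(2)] by simp
  qed
  moreover have "g ` topspace (pi0 X) = topspace (pi0 Y)"
    unfolding topspace_pi0 components_cod by (simp add: connected_components_of_def image_image g)
  moreover have "openin (pi0 X) {K \<in> topspace (pi0 X). g K \<in> \<C>} \<longleftrightarrow> openin (pi0 Y) \<C>"
    if \<C>: "\<C> \<subseteq> topspace (pi0 Y)" for \<C>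
  proof -
    let ?U = "{y \<in> topspace Y. connected_component_of_set Y y \<in> \<C>}"
    have "{x \<in> topspace X. connected_component_of_set X x \<in> {K \<in> topspace (pi0 X). g K \<in> \<C>}} =
      {x \<in> topspace X. f x \<in> ?U}"
      using g maps by (auto simp: topspace_pi0 connected_component_in_connected_components_of)
    moreover have "openin X {x \<in> topspace X. f x \<in> ?U} \<longleftrightarrow> openin Y ?U"
      by (rule open_vimage_saturated)
        (auto dest: connected_component_in_topspace connected_component_of_set_eq)
    ultimately show ?thesis using \<C> by (auto simp: openin_pi0 topspace_pi0)
  qed
  ultimately have "homeomorphic_map (pi0 X) (pi0 Y) g"
    by (simp add: homeomorphic_map_def quotient_map_def)
  then show thesis using that g by blast
qed

end

section \<open>Prime ideals and the Zariski topology\<close>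

context cring
begin

text \<open>An ideal that is maximal among those disjoint from a multiplicative set is prime. The
  maximality is kept in the conclusion so that the same lemma also yields maximal ideals.\<close>

lemma exists_prime_avoiding:
  assumes I: "ideal I R" and S: "S \<subseteq> carrier R" "\<one> \<in> S" "\<And>s t. \<lbrakk>s \<in> S; t \<in> S\<rbrakk> \<Longrightarrow> s \<otimes> t \<in> S"
    and disj: "I \<inter> S = {}"
  obtains P where "primeideal P R" "I \<subseteq> P" "P \<inter> S = {}"
    "\<And>J. \<lbrakk>ideal J R; P \<subseteq> J; J \<inter> S = {}\<rbrakk> \<Longrightarrow> J = P"
proof -
  define \<J> where "\<J> = {J. ideal J R \<and> I \<subseteq> J \<and> J \<inter> S = {}}"
  have "\<exists>M\<in>\<J>. \<forall>J\<in>\<J>. M \<subseteq> J \<longrightarrow> J = M"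
  proof (rule subset_Zorn_nonempty)
    show "\<J> \<noteq> {}" using I disj by (auto simp: \<J>_def)
    fix C assume C: "C \<noteq> {}" "subset.chain \<J> C"
    then have "subset.chain {J. ideal J R} C" by (auto simp: \<J>_def pred_on.chain_def)
    then have "ideal (\<Union>C) R" using chain_Union_is_ideal C(1) by presburger
    moreover have "C \<subseteq> \<J>" using C(2) by (simp add: pred_on.chain_def)
    ultimately show "\<Union>C \<in> \<J>" using C(1) unfolding \<J>_def by blast
  qed
  then obtain P where PJ: "P \<in> \<J>" and maxJ: "\<forall>J\<in>\<J>. P \<subseteq> J \<longrightarrow> J = P" ..
  then have P: "ideal P R" "I \<subseteq> P" "P \<inter> S = {}" by (simp_all add: \<J>_def)
  have max: "J = P" if "ideal J R" "P \<subseteq> J" "J \<inter> S = {}" for J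
  proof -
    have "J \<in> \<J>" using that P(2) by (simp add: \<J>_def)
    then show ?thesis using maxJ that(2) by blast
  qed
  interpret P: ideal P R by (rule P(1))
  have meets: "\<exists>p\<in>P. \<exists>x\<in>carrier R. p \<oplus> x \<otimes> a \<in> S" if a: "a \<in> carrier R" "a \<notin> P" for a
  proof -
    have "ideal (P <+>\<^bsub>R\<^esub> PIdl a) R" using a(1) by (intro add_ideals P(1) cgenideal_ideal)
    moreover have "P \<subseteq> P <+>\<^bsub>R\<^esub> PIdl a"
    proof
      fix p assume "p \<in> P"
      moreover from this have "p = p \<oplus> \<zero> \<otimes> a" using a(1) by simp
      ultimately show "p \<in> P <+>\<^bsub>R\<^esub> PIdl a" using zero_closed unfolding set_add_def' cgenideal_def by blast
    qed
    moreover have "a \<in> P <+>\<^bsub>R\<^esub> PIdl a"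
    proof -
      have "a = \<zero> \<oplus> \<one> \<otimes> a" using a(1) by simp
      then show ?thesis using P.zero_closed one_closed unfolding set_add_def' cgenideal_def by blast
    qed
    ultimately have "(P <+>\<^bsub>R\<^esub> PIdl a) \<inter> S \<noteq> {}" using max a(2) by blast
    then show ?thesis unfolding set_add_def' cgenideal_def by blast
  qed
  have "primeideal P R"
  proof (rule primeidealI[OF P(1) is_cring])
    show "carrier R \<noteq> P" using P(3) S(2) by auto
    fix a b assume ab: "a \<in> carrier R" "b \<in> carrier R" "a \<otimes> b \<in> P"
    show "a \<in> P \<or> b \<in> P"
    proof (rule ccontr)
      assume "\<not> (a \<in> P \<or> b \<in> P)"
      then obtain p x q y where pq: "p \<in> P" "x \<in> carrier R" "p \<oplus> x \<otimes> a \<in> S"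
        "q \<in> P" "y \<in> carrier R" "q \<oplus> y \<otimes> b \<in> S"
        using meets ab by metis
      have car: "p \<in> carrier R" "q \<in> carrier R" using pq P.Icarr by auto
      \<comment> \<open>The left side is a product of two elements of \<open>S\<close>. Every term
        of the expansion contains \<open>p\<close>, \<open>q\<close> or
        \<open>a \<otimes> b\<close>, each of which lies in \<open>P\<close>.\<close>
      have "(p \<oplus> x \<otimes> a) \<otimes> (q \<oplus> y \<otimes> b) = (q \<oplus> y \<otimes> b) \<otimes> p \<oplus> ((x \<otimes> a) \<otimes> q \<oplus> (x \<otimes> y) \<otimes> (a \<otimes> b))"
        using car pq ab by algebra
      also have "\<dots> \<in> P"
        by (intro P.a_closed P.I_l_closed[OF pq(1)] P.I_l_closed[OF pq(4)] P.I_l_closed[OF ab(3)])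
          (use car pq ab in auto)
      finally show False using S(3)[OF pq(3,6)] P(3) by blast
    qed
  qed
  then show thesis using that P max by blast
qed

text \<open>An ideal is proper exactly if it avoids the multiplicative set consisting of the unit
  element alone.\<close>

lemma exists_maximal_ideal:
  assumes "ideal I R" "\<one> \<notin> I"
  obtains M where "maximalideal M R" "I \<subseteq> M"
proof -
  obtain M where M: "primeideal M R" "I \<subseteq> M" "M \<inter> {\<one>} = {}"
    "\<And>J. \<lbrakk>ideal J R; M \<subseteq> J; J \<inter> {\<one>} = {}\<rbrakk> \<Longrightarrow> J = M"
    using exists_prime_avoiding[of I "{\<one>}"] assms by auto
  have "maximalideal M R"
  proof (rule maximalidealI)
    show "ideal M R" using M(1) by (simp add: primeideal_def)
    show "carrier R \<noteq> M" using M(3) by auto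
    fix J assume J: "ideal J R" "M \<subseteq> J"
    show "J = M \<or> J = carrier R"
      using M(4)[OF J] ideal.one_imp_carrier[OF J(1)] by blast
  qed
  then show thesis using that M(2) by blast
qed

lemma exists_prime_avoiding_powers:
  assumes "ideal I R" "a \<in> carrier R" "\<And>n::nat. a [^] n \<notin> I"
  obtains P where "primeideal P R" "I \<subseteq> P" "a \<notin> P"
proof -
  \<comment> \<open>Exponent one makes the prime avoid \<open>a\<close> itself; exponent zero puts
    the unit element into the multiplicative set.\<close>
  have "a [^] (1::nat) = a" using assms(2) by (rule nat_pow_eone)
  moreover have "\<one> = a [^] (0::nat)" by simp
  ultimately show thesis
    using exists_prime_avoiding[of I "range (\<lambda>n::nat. a [^] n)"] assms nat_pow_mult that
    by (smt (verit) disjoint_iff imageE image_subsetI nat_pow_closed rangeI)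
qed

lemma primeideal_pow:
  assumes "primeideal P R" "a \<in> carrier R" "a [^] (n::nat) \<in> P"
  shows "a \<in> P"
proof -
  interpret P: primeideal P R by (rule assms(1))
  show ?thesis using assms(3)
  proof (induction n)
    case 0
    then show ?case using P.one_imp_carrier P.I_notcarr by simp
  next
    case (Suc n)
    then show ?case using P.I_prime[of "a [^] n" a] assms(2) by auto
  qed
qed

end

section \<open>The standard open sets D(f) and quasi-compactness in the spectrum\<close>

definition basic_open :: "('a, 'm) ring_scheme \<Rightarrow> 'a \<Rightarrow> 'a set set" where
  "basic_open A f = {p \<in> primes A. f \<notin> p}"

lemma openin_basic_open: "f \<in> carrier A \<Longrightarrow> openin (zariski_topology A) (basic_open A f)"
  unfolding openin_zariski_topology zariski_open_def basic_open_def
  by (rule exI[of _ "{f}"]) auto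

lemma zariski_base:
  assumes "openin (zariski_topology A) U" "p \<in> U"
  obtains f where "f \<in> carrier A" "p \<in> basic_open A f" "basic_open A f \<subseteq> U"
proof -
  obtain E where E: "E \<subseteq> carrier A" "U = primes A - {p \<in> primes A. E \<subseteq> p}"
    using assms(1) unfolding openin_zariski_topology zariski_open_def by blast
  then obtain f where "f \<in> E" "f \<notin> p" using assms(2) by blast
  then show thesis using E assms(2) by (intro that[of f]) (auto simp: basic_open_def)
qed

context cring
begin

lemma basic_open_one: "basic_open R \<one> = primes R"
  unfolding basic_open_def primes_def
  using ideal.one_imp_carrier primeideal.I_notcarr primeideal.axioms(1) by blast

lemma basic_open_mult:
  assumes "f \<in> carrier R" "g \<in> carrier R"
  shows "basic_open R (f \<otimes> g) = basic_open R f \<inter> basic_open R g"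
proof -
  have "f \<otimes> g \<in> p \<longleftrightarrow> f \<in> p \<or> g \<in> p" if "primeideal p R" for p
    using primeideal.I_prime[OF that assms] ideal.I_l_closed ideal.I_r_closed assms
      primeideal.axioms(1)[OF that] by metis
  then show ?thesis by (auto simp: basic_open_def primes_def)
qed

text \<open>If no finite part of a cover by basic open sets suffices, then the union of the ideals
  generated by finitely many of the defining elements contains no power of \<open>f\<close>.\<close>

lemma compactin_basic_open:
  assumes f: "f \<in> carrier R"
  shows "compactin (zariski_topology R) (basic_open R f)"
  unfolding compactin_def
proof (intro conjI allI impI)
  show "basic_open R f \<subseteq> topspace (zariski_topology R)"
    by (auto simp: basic_open_def topspace_zariski_topology)
  fix \<U> assume "(\<forall>U\<in>\<U>. openin (zariski_topology R) U) \<and> basic_open R f \<subseteq> \<Union>\<U>"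
  then have op: "\<And>U. U \<in> \<U> \<Longrightarrow> openin (zariski_topology R) U" and cov: "basic_open R f \<subseteq> \<Union>\<U>" by auto
  \<comment> \<open>The sets \<open>basic_open R g\<close> for \<open>g\<close> in \<open>G\<close>
    refine the given cover, so finitely many of them lead back to finitely many cover
    members.\<close>
  define G where "G = {g \<in> carrier R. \<exists>U\<in>\<U>. basic_open R g \<subseteq> U}"
  define \<I> where "\<I> = {Idl F |F. finite F \<and> F \<subseteq> G}"
  have ideals: "\<And>I. I \<in> \<I> \<Longrightarrow> ideal I R" by (auto simp: \<I>_def G_def intro!: genideal_ideal)
  have sub: "F \<subseteq> Idl F" if "F \<subseteq> G" for F
    using that by (intro genideal_self) (auto simp: G_def)
  \<comment> \<open>Directedness is what makes the union of these ideals an ideal.\<close>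
  have directed: "\<exists>K\<in>\<I>. I \<subseteq> K \<and> J \<subseteq> K" if IJ: "I \<in> \<I>" "J \<in> \<I>" for I J
  proof -
    obtain F F' where F: "I = Idl F" "J = Idl F'" "finite F" "finite F'" "F \<subseteq> G" "F' \<subseteq> G"
      using IJ by (auto simp: \<I>_def)
    then have "Idl (F \<union> F') \<in> \<I>" by (auto simp: \<I>_def)
    moreover have "I \<subseteq> Idl (F \<union> F')" "J \<subseteq> Idl (F \<union> F')"
      unfolding F(1,2) using ideals[OF calculation] sub[of "F \<union> F'"] F(5,6)
      by (simp_all add: genideal_minimal)
    ultimately show ?thesis by blast
  qed
  have ideal: "ideal (\<Union>\<I>) R"
  proof (rule idealI[OF ring_axioms])
    show "subgroup (\<Union>\<I>) (add_monoid R)"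
    proof (rule add.subgroupI)
      show "\<Union>\<I> \<subseteq> carrier R" using ideal.Icarr[OF ideals] by auto
      have "Idl {} \<in> \<I>" by (auto simp: \<I>_def)
      moreover have "\<zero> \<in> Idl {}"
        by (rule additive_subgroup.zero_closed[OF ideal.axioms(1)[OF ideals[OF calculation]]])
      ultimately show "\<Union>\<I> \<noteq> {}" by blast
    next
      fix a assume "a \<in> \<Union>\<I>"
      then obtain I where I: "I \<in> \<I>" "a \<in> I" by (rule UnionE)
      have "\<ominus> a \<in> I"
        using additive_subgroup.a_inv_closed[OF ideal.axioms(1)[OF ideals[OF I(1)]] I(2)] .
      then show "\<ominus> a \<in> \<Union>\<I>" using I(1) by auto
    next
      fix a b assume "a \<in> \<Union>\<I>" "b \<in> \<Union>\<I>"
      then obtain I J where IJ: "I \<in> \<I>" "J \<in> \<I>" "a \<in> I" "b \<in> J" by auto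
      obtain K where K: "K \<in> \<I>" "I \<subseteq> K" "J \<subseteq> K" using directed[OF IJ(1,2)] by auto
      have "a \<oplus> b \<in> K"
        using additive_subgroup.a_closed[OF ideal.axioms(1)[OF ideals[OF K(1)]]] IJ K by auto
      then show "a \<oplus> b \<in> \<Union>\<I>" using K(1) by auto
    qed
  next
    fix a x assume "a \<in> \<Union>\<I>" and x: "x \<in> carrier R"
    then obtain I where I: "I \<in> \<I>" "a \<in> I" by auto
    then show "x \<otimes> a \<in> \<Union>\<I>" "a \<otimes> x \<in> \<Union>\<I>"
      using ideal.I_l_closed[OF ideals[OF I(1)] I(2) x] ideal.I_r_closed[OF ideals[OF I(1)] I(2) x]
      by auto
  qed
  have GI: "G \<subseteq> \<Union>\<I>"
  proof
    fix g assume "g \<in> G"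
    then have "Idl {g} \<in> \<I>" "g \<in> Idl {g}" using sub[of "{g}"] by (auto simp: \<I>_def)
    then show "g \<in> \<Union>\<I>" by blast
  qed
  \<comment> \<open>A prime containing the union but not \<open>f\<close> lies in some cover member,
    hence in \<open>basic_open R g\<close> for some \<open>g\<close> in \<open>G\<close>. But
    \<open>G\<close> is contained in the union, so that prime contains \<open>g\<close>.\<close>
  have "\<exists>n::nat. f [^] n \<in> \<Union>\<I>"
  proof (rule ccontr)
    assume "\<nexists>n::nat. f [^] n \<in> \<Union>\<I>"
    then have "f [^] n \<notin> \<Union>\<I>" for n :: nat by iprover
    then obtain P where P: "primeideal P R" "\<Union>\<I> \<subseteq> P" "f \<notin> P"
      by (rule exists_prime_avoiding_powers[OF ideal f])
    then obtain U where U: "U \<in> \<U>" "P \<in> U" using cov by (auto simp: basic_open_def primes_def)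
    obtain g where g: "g \<in> carrier R" "P \<in> basic_open R g" "basic_open R g \<subseteq> U"
      using zariski_base[OF op[OF U(1)] U(2)] by blast
    then have "g \<in> P" using U GI P(2) by (auto simp: G_def)
    then show False using g(2) by (simp add: basic_open_def)
  qed
  then obtain n :: nat and F where F: "f [^] n \<in> Idl F" "finite F" "F \<subseteq> G" by (auto simp: \<I>_def)
  have "\<forall>g\<in>F. \<exists>U. U \<in> \<U> \<and> basic_open R g \<subseteq> U" using F(3) by (auto simp: G_def)
  then obtain u where u: "\<forall>g\<in>F. u g \<in> \<U> \<and> basic_open R g \<subseteq> u g" by (rule bchoice[THEN exE])
  have "basic_open R f \<subseteq> \<Union>(u ` F)"
  proof
    fix P assume P: "P \<in> basic_open R f"
    then have prime: "primeideal P R" by (simp add: basic_open_def primes_def)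
    then interpret P: primeideal P R .
    \<comment> \<open>A prime containing \<open>F\<close> contains the ideal generated by
      \<open>F\<close>, hence a power of \<open>f\<close>, hence \<open>f\<close>.\<close>
    have "\<not> F \<subseteq> P"
    proof
      assume "F \<subseteq> P"
      then have "f [^] n \<in> P" using genideal_minimal[OF P.is_ideal] F(1) by blast
      then show False using primeideal_pow[OF prime f] P by (simp add: basic_open_def)
    qed
    then obtain g where "g \<in> F" "P \<in> basic_open R g"
      using P by (auto simp: basic_open_def)
    then show "P \<in> \<Union>(u ` F)" using u by blast
  qed
  then show "\<exists>\<F>. finite \<F> \<and> \<F> \<subseteq> \<U> \<and> basic_open R f \<subseteq> \<Union>\<F>"
    using F(2) u by (intro exI[of _ "u ` F"]) auto
qed

lemma compact_space_zariski: "compact_space (zariski_topology R)"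
  using compactin_basic_open[OF one_closed]
  by (simp add: basic_open_one compact_space_def topspace_zariski_topology)

lemma compact_open_finite_union:
  assumes "openin (zariski_topology R) U" "compactin (zariski_topology R) U"
  obtains F where "finite F" "F \<subseteq> carrier R" "U = (\<Union>f\<in>F. basic_open R f)"
proof -
  define G where "G = {f \<in> carrier R. basic_open R f \<subseteq> U}"
  have "U \<subseteq> \<Union>(basic_open R ` G)" 
  proof
    fix p assume "p \<in> U"
    then obtain f where "f \<in> carrier R" "p \<in> basic_open R f" "basic_open R f \<subseteq> U"
      by (rule zariski_base[OF assms(1)])
    then show "p \<in> \<Union>(basic_open R ` G)" by (auto simp: G_def)
  qed
  moreover have "\<forall>V\<in>basic_open R ` G. openin (zariski_topology R) V"
    by (auto simp: G_def openin_basic_open)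
  ultimately obtain \<F> where \<F>: "finite \<F>" "\<F> \<subseteq> basic_open R ` G" "U \<subseteq> \<Union>\<F>"
    using assms(2) unfolding compactin_def by metis
  then obtain F where "finite F" "F \<subseteq> G" "\<F> = basic_open R ` F" by (meson finite_subset_image)
  then show thesis using \<F>(3) by (intro that[of F]) (auto simp: G_def)
qed

text \<open>This is quasi-separatedness of the spectrum: intersections of basic open sets are basic,
  and intersection distributes over the two finite unions.\<close>

lemma compactin_zariski_Int:
  assumes U: "openin (zariski_topology R) U" "compactin (zariski_topology R) U"
    and V: "openin (zariski_topology R) V" "compactin (zariski_topology R) V"
  shows "compactin (zariski_topology R) (U \<inter> V)"
proof -
  obtain F G where F: "finite F" "F \<subseteq> carrier R" "U = (\<Union>f\<in>F. basic_open R f)"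
    and G: "finite G" "G \<subseteq> carrier R" "V = (\<Union>g\<in>G. basic_open R g)"
    using compact_open_finite_union[OF U] compact_open_finite_union[OF V] by metis
  have "U \<inter> V = (\<Union>(f, g)\<in>F \<times> G. basic_open R (f \<otimes> g))"
    using F G by (auto simp: basic_open_mult subset_iff)
  moreover have "compactin (zariski_topology R) \<dots>"
    using F G by (intro compactin_Union) (auto intro!: compactin_basic_open)
  ultimately show ?thesis by simp
qed

lemma quasi_eq_connected_component_of_zariski:
  "quasi_component_of (zariski_topology R) p = connected_component_of (zariski_topology R) p"
proof (rule quasi_eq_connected_component_of_compact_base)
  fix U p assume U: "openin (zariski_topology R) U" "p \<in> U"
  obtain f where "f \<in> carrier R" "p \<in> basic_open R f" "basic_open R f \<subseteq> U"
    using zariski_base[OF U] .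
  then show "\<exists>K. openin (zariski_topology R) K \<and> compactin (zariski_topology R) K \<and> p \<in> K \<and> K \<subseteq> U"
    by (intro exI[of _ "basic_open R f"] conjI openin_basic_open compactin_basic_open)
qed (simp_all add: compact_space_zariski compactin_zariski_Int)

section \<open>Comaximal ideals, idempotents and clopen subsets of the spectrum\<close>

lemma comaximal_elements:
  assumes "ideal I R" "ideal J R" "\<And>P. \<lbrakk>primeideal P R; I \<subseteq> P; J \<subseteq> P\<rbrakk> \<Longrightarrow> False"
  obtains a b where "a \<in> I" "b \<in> J" "a \<oplus> b = \<one>"
proof -
  \<comment> \<open>If the sum were proper, a maximal ideal above it would be a prime containing
    both \<open>I\<close> and \<open>J\<close>.\<close>
  have "\<one> \<in> I <+>\<^bsub>R\<^esub> J"
  proof (rule ccontr)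
    assume "\<one> \<notin> I <+>\<^bsub>R\<^esub> J"
    then obtain M where M: "maximalideal M R" "I <+>\<^bsub>R\<^esub> J \<subseteq> M"
      using exists_maximal_ideal[OF add_ideals[OF assms(1,2)]] by blast
    have "I \<subseteq> I <+>\<^bsub>R\<^esub> J" "J \<subseteq> I <+>\<^bsub>R\<^esub> J"
    proof -
      show "I \<subseteq> I <+>\<^bsub>R\<^esub> J"
      proof
        fix a assume "a \<in> I"
        moreover have "\<zero> \<in> J" using assms(2) by (simp add: additive_subgroup.zero_closed ideal.axioms(1))
        ultimately show "a \<in> I <+>\<^bsub>R\<^esub> J"
          using ideal.Icarr[OF assms(1)] r_zero unfolding set_add_def' by fastforce
      qed
      show "J \<subseteq> I <+>\<^bsub>R\<^esub> J"
      proof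
        fix b assume "b \<in> J"
        moreover have "\<zero> \<in> I" using assms(1) by (simp add: additive_subgroup.zero_closed ideal.axioms(1))
        ultimately show "b \<in> I <+>\<^bsub>R\<^esub> J"
          using ideal.Icarr[OF assms(2)] l_zero unfolding set_add_def' by fastforce
      qed
    qed
    then show False using assms(3)[OF maximalideal_prime[OF M(1)]] M(2) by blast
  qed
  then have "\<exists>a\<in>I. \<exists>b\<in>J. a \<oplus> b = \<one>" unfolding set_add_def' by force
  then show thesis using that by blast
qed

text \<open>A prime contains exactly one of \<open>e\<close> and \<open>\<one> \<ominus> e\<close>:
  their product is zero and their sum is one.\<close>

lemma basic_open_idempotent_compl:
  assumes "e \<in> carrier R" "e \<otimes> e = e"
  shows "basic_open R (\<one> \<ominus> e) = primes R - basic_open R e"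
proof -
  have "(\<one> \<ominus> e \<in> p) \<longleftrightarrow> e \<notin> p" if "primeideal p R" for p
  proof -
    interpret p: primeideal p R by (rule that)
    have "e \<otimes> (\<one> \<ominus> e) = \<zero>" using assms by (simp add: minus_eq r_distr r_minus r_neg)
    then have "e \<in> p \<or> \<one> \<ominus> e \<in> p" using p.I_prime[of e "\<one> \<ominus> e"] assms p.zero_closed by auto
    moreover have "False" if "e \<in> p" "\<one> \<ominus> e \<in> p"
    proof -
      have "(\<one> \<ominus> e) \<oplus> e = \<one>" using assms by algebra
      then show False using p.a_closed[OF that(2,1)] p.one_imp_carrier p.I_notcarr by simp
    qed
    ultimately show ?thesis by blast
  qed
  then show ?thesis by (auto simp: basic_open_def primes_def)
qed

lemma closedin_basic_open_idempotent:
  assumes "e \<in> carrier R" "e \<otimes> e = e"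
  shows "closedin (zariski_topology R) (basic_open R e)"
  unfolding closedin_def topspace_zariski_topology
  using openin_basic_open[of "\<one> \<ominus> e" R] assms
  by (simp add: basic_open_idempotent_compl) (auto simp: basic_open_def)

text \<open>Comaximal elements \<open>a\<close>, \<open>b\<close> defining the two closed pieces have a nilpotent product. Powers
  \<open>a\<^sup>n\<close>, \<open>b\<^sup>n\<close> with product zero are still comaximal, which turns the decomposition of
  \<open>\<one>\<close> into complementary idempotents.\<close>

lemma clopen_zariski_idempotent:
  assumes "openin (zariski_topology R) W" "closedin (zariski_topology R) W"
  obtains e where "e \<in> carrier R" "e \<otimes> e = e" "W = basic_open R e"
proof -
  obtain E where E: "E \<subseteq> carrier R" "W = primes R - {p \<in> primes R. E \<subseteq> p}"
    using assms(1) unfolding openin_zariski_topology zariski_open_def by blast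
  obtain F where F: "F \<subseteq> carrier R" "primes R - W = primes R - {p \<in> primes R. F \<subseteq> p}"
    using assms(2) unfolding closedin_def openin_zariski_topology topspace_zariski_topology
      zariski_open_def by blast
  have W: "W = {p \<in> primes R. F \<subseteq> p}" using E F by blast
  have Idl: "Idl H \<subseteq> p \<longleftrightarrow> H \<subseteq> p" if "H \<subseteq> carrier R" "primeideal p R" for H p
    using that by (simp add: Idl_subset_ideal primeideal.axioms(1))
  have "False" if "primeideal P R" "Idl E \<subseteq> P" "Idl F \<subseteq> P" for P
    using that E F W by (auto simp: Idl primes_def)
  then obtain a b where ab: "a \<in> Idl E" "b \<in> Idl F" "a \<oplus> b = \<one>"
    using comaximal_elements[OF genideal_ideal[OF E(1)] genideal_ideal[OF F(1)]] by metis
  have car: "a \<in> carrier R" "b \<in> carrier R"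
    using ab genideal_ideal E(1) F(1) ideal.Icarr by metis+
  have aW: "a \<in> p" if "primeideal p R" "p \<notin> W" for p
  proof -
    have "E \<subseteq> p" using that E(2) by (simp add: primes_def)
    then show ?thesis using ab(1) Idl[OF E(1) that(1)] by blast
  qed
  have bW: "b \<in> p" if "primeideal p R" "p \<in> W" for p
  proof -
    have "F \<subseteq> p" using that(2) W by simp
    then show ?thesis using ab(2) Idl[OF F(1) that(1)] by blast
  qed
  \<comment> \<open>Each prime contains \<open>b\<close> or \<open>a\<close>, according to whether
    it lies in \<open>W\<close>. So the product lies in every prime and must be nilpotent.\<close>
  have "\<exists>n::nat. (a \<otimes> b) [^] n \<in> {\<zero>}"
  proof (rule ccontr)
    assume "\<nexists>n::nat. (a \<otimes> b) [^] n \<in> {\<zero>}"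
    then obtain P where P: "primeideal P R" "a \<otimes> b \<notin> P"
      using exists_prime_avoiding_powers[OF zeroideal, of "a \<otimes> b"] car by blast
    have I: "ideal P R" using P(1) by (simp add: primeideal.axioms(1))
    have "a \<in> P \<or> b \<in> P" using aW[OF P(1)] bW[OF P(1)] by blast
    then show False
      using P(2) car ideal.I_l_closed[OF I, of b a] ideal.I_r_closed[OF I, of a b] by blast
  qed
  then obtain n :: nat where "(a \<otimes> b) [^] n = \<zero>" by blast
  \<comment> \<open>The exponent is made positive so that a prime containing \<open>a\<close> or
    \<open>b\<close> also contains the corresponding power, which fails for exponent zero.\<close>
  then have "(a \<otimes> b) [^] Suc n = \<zero>" using car by simp
  then have n: "a [^] Suc n \<otimes> b [^] Suc n = \<zero>" using car by (metis nat_pow_distrib)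
  \<comment> \<open>A prime containing both powers would contain \<open>a\<close> and
    \<open>b\<close>, hence their sum, which is one.\<close>
  have "False" if P: "primeideal P R" "PIdl (a [^] Suc n) \<subseteq> P" "PIdl (b [^] Suc n) \<subseteq> P" for P
  proof -
    interpret P: primeideal P R by (rule P(1))
    have "a [^] Suc n \<in> P" "b [^] Suc n \<in> P"
      using P(2,3) cgenideal_self nat_pow_closed car by blast+
    then have "a \<in> P" "b \<in> P" using primeideal_pow[OF P(1)] car by blast+
    then show False using P.a_closed ab(3) P.one_imp_carrier P.I_notcarr by metis
  qed
  then obtain e e' where ee: "e \<in> PIdl (a [^] Suc n)" "e' \<in> PIdl (b [^] Suc n)" "e \<oplus> e' = \<one>"
    using comaximal_elements cgenideal_ideal nat_pow_closed car by metis
  then obtain x y where xy: "x \<in> carrier R" "y \<in> carrier R" "e = x \<otimes> a [^] Suc n" "e' = y \<otimes> b [^] Suc n"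
    unfolding cgenideal_def by blast
  have ecar: "e \<in> carrier R" "e' \<in> carrier R" using xy car by auto
  have "e \<otimes> e' = (x \<otimes> y) \<otimes> (a [^] Suc n \<otimes> b [^] Suc n)"
    unfolding xy(3,4) using xy(1,2) nat_pow_closed[OF car(1)] nat_pow_closed[OF car(2)]
    by (metis m_closed m_lcomm m_assoc)
  also have "\<dots> = \<zero>" unfolding n using xy by simp
  finally have zero: "e \<otimes> e' = \<zero>" .
  have "e = e \<otimes> (e \<oplus> e')" using ee(3) ecar by simp
  also have "\<dots> = e \<otimes> e" using zero ecar by (simp add: r_distr)
  finally have idem: "e \<otimes> e = e" by simp
  \<comment> \<open>Off \<open>W\<close> every prime contains \<open>a\<close> and hence
    \<open>e\<close>; on \<open>W\<close> every prime contains \<open>b\<close> and hence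
    \<open>e'\<close>. No prime contains both, as they sum to one.\<close>
  have "e \<in> p \<longleftrightarrow> p \<notin> W" if p: "primeideal p R" for p
  proof -
    interpret p: primeideal p R by (rule p)
    have pow: "c [^] Suc n \<in> p" if "c \<in> p" for c
      using that p.I_l_closed[OF that] p.Icarr by simp
    have "e \<in> p" if "p \<notin> W" using aW[OF p that] pow xy(1) unfolding xy(3) by (intro p.I_l_closed)
    moreover have "e' \<in> p" if "p \<in> W" using bW[OF p that] pow xy(2) unfolding xy(4) by (intro p.I_l_closed)
    moreover have "\<not> (e \<in> p \<and> e' \<in> p)" using p.a_closed ee(3) p.one_imp_carrier p.I_notcarr by metis
    ultimately show ?thesis by blast
  qed
  then have "W = basic_open R e" using E by (auto simp: basic_open_def primes_def)
  then show thesis using that ecar idem by blast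
qed

end

section \<open>Idempotent global sections\<close>

context ringed_space
begin

section \<open>Germs and the homomorphism from global sections to a stalk\<close>

lemma restr_closed:
  "\<lbrakk>openin (top_of X) U; openin (top_of X) V; V \<subseteq> U; s \<in> carrier (sect X U)\<rbrakk>
    \<Longrightarrow> restr X U V s \<in> carrier (sect X V)"
  using restr_hom by (rule ring_hom_closed)

lemma germ_rel_iff:
  "((U, s), (V, t)) \<in> germ_rel X x \<longleftrightarrow>
    (U, s) \<in> local_sections X x \<and> (V, t) \<in> local_sections X x \<and>
    (\<exists>W. openin (top_of X) W \<and> x \<in> W \<and> W \<subseteq> U \<inter> V \<and> restr X U W s = restr X V W t)"
  by (simp add: germ_rel_def)

lemma local_sections_iff:
  "(U, s) \<in> local_sections X x \<longleftrightarrow> openin (top_of X) U \<and> x \<in> U \<and> s \<in> carrier (sect X U)"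
  by (simp add: local_sections_def)

lemma equiv_germ_rel: "equiv (local_sections X x) (germ_rel X x)"
proof (rule equivI)
  show "germ_rel X x \<subseteq> local_sections X x \<times> local_sections X x"
    by (auto simp: germ_rel_def)
  show "refl_on (local_sections X x) (germ_rel X x)"
    by (auto simp: refl_on_def germ_rel_iff local_sections_iff)
  show "sym (germ_rel X x)"
    by (rule symI) (auto simp: germ_rel_iff, metis)
  show "trans (germ_rel X x)"
  proof (rule transI, clarify)
    fix U s V t W r
    assume "((U, s), (V, t)) \<in> germ_rel X x" "((V, t), (W, r)) \<in> germ_rel X x"
    then obtain A B where
      A: "openin (top_of X) A" "x \<in> A" "A \<subseteq> U \<inter> V" "restr X U A s = restr X V A t" and
      B: "openin (top_of X) B" "x \<in> B" "B \<subseteq> V \<inter> W" "restr X V B t = restr X W B r" and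
      ls: "(U, s) \<in> local_sections X x" "(V, t) \<in> local_sections X x" "(W, r) \<in> local_sections X x"
      by (auto simp: germ_rel_iff)
    have car: "openin (top_of X) U" "openin (top_of X) V" "openin (top_of X) W"
      "s \<in> carrier (sect X U)" "t \<in> carrier (sect X V)" "r \<in> carrier (sect X W)"
      using ls by (auto simp: local_sections_iff)
    have AB: "openin (top_of X) (A \<inter> B)" using A B by blast
    have "restr X U (A \<inter> B) s = restr X A (A \<inter> B) (restr X U A s)"
      using A B car AB by (subst restr_comp) auto
    also have "\<dots> = restr X V (A \<inter> B) t"
      unfolding A(4) using A B car AB by (subst restr_comp) auto
    also have "\<dots> = restr X B (A \<inter> B) (restr X V B t)"
      using A B car AB by (subst restr_comp) auto
    also have "\<dots> = restr X W (A \<inter> B) r"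
      unfolding B(4) using A B car AB by (subst restr_comp) auto
    finally show "((U, s), (W, r)) \<in> germ_rel X x"
      unfolding germ_rel_iff using ls A B AB by (intro conjI exI[of _ "A \<inter> B"]) auto
  qed
qed

lemma germ_eq_iff:
  assumes "(U, s) \<in> local_sections X x" "(V, t) \<in> local_sections X x"
  shows "germ X x U s = germ X x V t \<longleftrightarrow>
    (\<exists>W. openin (top_of X) W \<and> x \<in> W \<and> W \<subseteq> U \<inter> V \<and> restr X U W s = restr X V W t)"
  unfolding germ_def using eq_equiv_class_iff[OF equiv_germ_rel assms] assms
  by (simp add: germ_rel_iff)

lemma germ_in_stalk: "(U, s) \<in> local_sections X x \<Longrightarrow> germ X x U s \<in> carrier (stalk X x)"
  by (simp add: stalk_def germ_def quotientI)

text \<open>The stalk operations unite over all pairs of representatives; independence of the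
  representatives makes this a union of equal sets. The parameter \<open>opn\<close> lets one
  argument serve both multiplication and addition, using only compatibility with
  restriction.\<close>

lemma germ_image2:
  fixes opn :: "'b ring \<Rightarrow> 'b \<Rightarrow> 'b \<Rightarrow> 'b"
  assumes hom: "\<And>U V s t. \<lbrakk>openin (top_of X) U; openin (top_of X) V; V \<subseteq> U;
      s \<in> carrier (sect X U); t \<in> carrier (sect X U)\<rbrakk>
      \<Longrightarrow> opn (sect X U) s t \<in> carrier (sect X U) \<and>
        restr X U V (opn (sect X U) s t) = opn (sect X V) (restr X U V s) (restr X U V t)"
    and s: "(U, s) \<in> local_sections X x" and t: "(U, t) \<in> local_sections X x"
  shows "(\<Union>(U', s')\<in>germ X x U s. \<Union>(V', t')\<in>germ X x U t.
      germ X x (U' \<inter> V') (opn (sect X (U' \<inter> V')) (restr X U' (U' \<inter> V') s') (restr X V' (U' \<inter> V') t'))) =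
    germ X x U (opn (sect X U) s t)"
proof -
  have eq: "germ X x (U' \<inter> V') (opn (sect X (U' \<inter> V')) (restr X U' (U' \<inter> V') s') (restr X V' (U' \<inter> V') t')) =
      germ X x U (opn (sect X U) s t)"
    if rel: "((U, s), (U', s')) \<in> germ_rel X x" "((U, t), (V', t')) \<in> germ_rel X x" for U' V' s' t'
  proof -
    obtain A B where
      A: "openin (top_of X) A" "x \<in> A" "A \<subseteq> U \<inter> U'" "restr X U A s = restr X U' A s'" and
      B: "openin (top_of X) B" "x \<in> B" "B \<subseteq> U \<inter> V'" "restr X U B t = restr X V' B t'"
      using rel unfolding germ_rel_iff by blast
    \<comment> \<open>On \<open>C\<close> both pairs of representatives agree, so the two results
      have the same restriction there.\<close>
    define C where "C = A \<inter> B"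
    have C: "openin (top_of X) C" "x \<in> C" "C \<subseteq> A" "C \<subseteq> B" using A B by (auto simp: C_def)
    define D where "D = U' \<inter> V'"
    have ls: "openin (top_of X) U" "x \<in> U" "s \<in> carrier (sect X U)" "t \<in> carrier (sect X U)"
      "openin (top_of X) U'" "s' \<in> carrier (sect X U')" "openin (top_of X) V'" "t' \<in> carrier (sect X V')"
      using rel by (auto simp: germ_rel_iff local_sections_iff)
    have D: "openin (top_of X) D" "x \<in> D" "D \<subseteq> U'" "D \<subseteq> V'" "C \<subseteq> D" "C \<subseteq> U"
      using A B C ls by (auto simp: D_def)
    have s': "restr X U' D s' \<in> carrier (sect X D)" "restr X V' D t' \<in> carrier (sect X D)"
      using D ls by (auto intro: restr_closed)
    have "restr X U C s = restr X A C (restr X U A s)"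
      using A C ls by (subst restr_comp) auto
    also have "\<dots> = restr X U' C s'"
      unfolding A(4) using A C ls by (subst restr_comp) auto
    also have "\<dots> = restr X D C (restr X U' D s')"
      using C D ls by (subst restr_comp) auto
    finally have 1: "restr X U C s = restr X D C (restr X U' D s')" .
    have "restr X U C t = restr X B C (restr X U B t)"
      using B C ls by (subst restr_comp) auto
    also have "\<dots> = restr X V' C t'"
      unfolding B(4) using B C ls by (subst restr_comp) auto
    also have "\<dots> = restr X D C (restr X V' D t')"
      using C D ls by (subst restr_comp) auto
    finally have 2: "restr X U C t = restr X D C (restr X V' D t')" .
    show ?thesis
      unfolding D_def[symmetric]
    proof (subst germ_eq_iff)
      show "(D, opn (sect X D) (restr X U' D s') (restr X V' D t')) \<in> local_sections X x"
        using hom[of D D, OF D(1) D(1) subset_refl s'] D by (simp add: local_sections_iff)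
      show "(U, opn (sect X U) s t) \<in> local_sections X x"
        using hom[of U U s t] ls by (simp add: local_sections_iff)
      have "restr X D C (opn (sect X D) (restr X U' D s') (restr X V' D t')) =
          restr X U C (opn (sect X U) s t)"
        using hom[OF D(1) C(1) D(5) s'] hom[OF ls(1) C(1) D(6) ls(3,4)] 1 2 by simp
      then show "\<exists>W. openin (top_of X) W \<and> x \<in> W \<and> W \<subseteq> D \<inter> U \<and>
          restr X D W (opn (sect X D) (restr X U' D s') (restr X V' D t')) =
          restr X U W (opn (sect X U) s t)"
        using C D by (intro exI[of _ C]) simp
    qed
  qed
  \<comment> \<open>A union of equal sets is their common value only if the index set is
    nonempty.\<close>
  have ne: "germ X x U s \<noteq> {}" "germ X x U t \<noteq> {}"
    using equiv_class_self[OF equiv_germ_rel] s t by (auto simp: germ_def)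
  show ?thesis
  proof (rule SUP_eq_const[OF ne(1)], clarify)
    fix U' s' assume s': "(U', s') \<in> germ X x U s"
    show "(\<Union>(V', t')\<in>germ X x U t.
        germ X x (U' \<inter> V') (opn (sect X (U' \<inter> V')) (restr X U' (U' \<inter> V') s') (restr X V' (U' \<inter> V') t'))) =
      germ X x U (opn (sect X U) s t)"
    proof (rule SUP_eq_const[OF ne(2)], clarify)
      fix V' t' assume "(V', t') \<in> germ X x U t"
      then show "germ X x (U' \<inter> V') (opn (sect X (U' \<inter> V')) (restr X U' (U' \<inter> V') s') (restr X V' (U' \<inter> V') t')) =
          germ X x U (opn (sect X U) s t)"
        using s' by (intro eq) (simp_all add: germ_def)
    qed
  qed
qed

lemma germ_ring_hom:
  assumes x: "x \<in> topspace (top_of X)"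
  shows "germ X x (topspace (top_of X)) \<in> ring_hom (global_sections X) (stalk X x)"
proof (rule ring_hom_memI)
  have ls: "(topspace (top_of X), s) \<in> local_sections X x" if "s \<in> carrier (global_sections X)" for s
    using that x by (simp add: local_sections_iff global_sections_def)
  fix s assume s: "s \<in> carrier (global_sections X)"
  show "germ X x (topspace (top_of X)) s \<in> carrier (stalk X x)" by (rule germ_in_stalk[OF ls[OF s]])
  fix t assume t: "t \<in> carrier (global_sections X)"
  have mult: "s \<otimes>\<^bsub>sect X U\<^esub> t \<in> carrier (sect X U) \<and>
      restr X U V (s \<otimes>\<^bsub>sect X U\<^esub> t) = restr X U V s \<otimes>\<^bsub>sect X V\<^esub> restr X U V t"
    and add: "s \<oplus>\<^bsub>sect X U\<^esub> t \<in> carrier (sect X U) \<and>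
      restr X U V (s \<oplus>\<^bsub>sect X U\<^esub> t) = restr X U V s \<oplus>\<^bsub>sect X V\<^esub> restr X U V t"
    if "openin (top_of X) U" "openin (top_of X) V" "V \<subseteq> U"
      "s \<in> carrier (sect X U)" "t \<in> carrier (sect X U)" for U V s t
  proof -
    interpret U: cring "sect X U" by (rule cring_sect[OF that(1)])
    show "s \<otimes>\<^bsub>sect X U\<^esub> t \<in> carrier (sect X U) \<and>
        restr X U V (s \<otimes>\<^bsub>sect X U\<^esub> t) = restr X U V s \<otimes>\<^bsub>sect X V\<^esub> restr X U V t"
      "s \<oplus>\<^bsub>sect X U\<^esub> t \<in> carrier (sect X U) \<and>
        restr X U V (s \<oplus>\<^bsub>sect X U\<^esub> t) = restr X U V s \<oplus>\<^bsub>sect X V\<^esub> restr X U V t"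
      using that ring_hom_mult[OF restr_hom[OF that(1-3)]] ring_hom_add[OF restr_hom[OF that(1-3)]]
      by auto
  qed
  show "germ X x (topspace (top_of X)) (s \<otimes>\<^bsub>global_sections X\<^esub> t) =
      germ X x (topspace (top_of X)) s \<otimes>\<^bsub>stalk X x\<^esub> germ X x (topspace (top_of X)) t"
    using germ_image2[where opn = "\<lambda>A. (\<otimes>\<^bsub>A\<^esub>)", OF mult ls[OF s] ls[OF t]]
    by (simp add: stalk_def global_sections_def)
  show "germ X x (topspace (top_of X)) (s \<oplus>\<^bsub>global_sections X\<^esub> t) =
      germ X x (topspace (top_of X)) s \<oplus>\<^bsub>stalk X x\<^esub> germ X x (topspace (top_of X)) t"
    using germ_image2[where opn = "\<lambda>A. (\<oplus>\<^bsub>A\<^esub>)", OF add ls[OF s] ls[OF t]]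
    by (simp add: stalk_def global_sections_def)
next
  show "germ X x (topspace (top_of X)) \<one>\<^bsub>global_sections X\<^esub> = \<one>\<^bsub>stalk X x\<^esub>"
    by (simp add: stalk_def)
qed

section \<open>Restricting and gluing global sections\<close>

lemma cring_global_sections: "cring (global_sections X)"
  by (simp add: global_sections_def cring_sect)

lemma restr_ring_hom_ring:
  assumes "openin (top_of X) U"
  shows "ring_hom_ring (global_sections X) (sect X U) (restr X (topspace (top_of X)) U)"
  using restr_hom[OF _ assms, of "topspace (top_of X)"] openin_subset[OF assms]
    cring.axioms(1)[OF cring_sect[OF assms]] cring.axioms(1)[OF cring_global_sections]
  by (intro ring_hom_ringI2) (simp_all add: global_sections_def)

text \<open>The open sets on which \<open>s\<close> and \<open>t\<close> agree cover the space, and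
  both sections glue the same family of restrictions, so uniqueness in \<open>glue\<close>
  identifies them.\<close>

lemma global_section_eqI:
  assumes s: "s \<in> carrier (global_sections X)" and t: "t \<in> carrier (global_sections X)"
    and local: "\<And>x. x \<in> topspace (top_of X) \<Longrightarrow> \<exists>W. openin (top_of X) W \<and> x \<in> W \<and>
      restr X (topspace (top_of X)) W s = restr X (topspace (top_of X)) W t"
  shows "s = t"
proof -
  let ?T = "topspace (top_of X)"
  define \<U> where "\<U> = {W. openin (top_of X) W \<and> restr X ?T W s = restr X ?T W t}"
  have op: "openin (top_of X) U" "U \<subseteq> ?T" if "U \<in> \<U>" for U
    using that openin_subset by (auto simp: \<U>_def)
  have car: "s \<in> carrier (sect X ?T)" "t \<in> carrier (sect X ?T)"
    using s t by (simp_all add: global_sections_def)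
  have "\<Union>\<U> = ?T" using local op(2) by (fastforce simp: \<U>_def)
  moreover have "\<exists>!r. r \<in> carrier (sect X (\<Union>\<U>)) \<and> (\<forall>U\<in>\<U>. restr X (\<Union>\<U>) U r = restr X ?T U s)"
  proof (rule glue)
    fix U V assume "U \<in> \<U>" "V \<in> \<U>"
    then show "restr X U (U \<inter> V) (restr X ?T U s) = restr X V (U \<inter> V) (restr X ?T V s)"
      using op car by (simp add: restr_comp openin_Int)
  qed (use op car in \<open>auto intro: restr_closed\<close>)
  ultimately have "\<exists>!r. r \<in> carrier (sect X ?T) \<and> (\<forall>U\<in>\<U>. restr X ?T U r = restr X ?T U s)" by simp
  then show ?thesis using car by (metis (mono_tags, lifting) \<U>_def mem_Collect_eq)
qed

text \<open>Uniqueness in \<open>glue\<close> for the empty cover, where every section over the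
  empty set is a gluing.\<close>

lemma sect_empty: "\<lbrakk>s \<in> carrier (sect X {}); t \<in> carrier (sect X {})\<rbrakk> \<Longrightarrow> s = t"
  using glue[of "{}" undefined] by auto

text \<open>The sections one on \<open>Z\<close> and zero on its complement glue, since over the
  empty overlap any two sections are equal.\<close>

lemma clopen_indicator_section:
  assumes Z: "openin (top_of X) Z" "closedin (top_of X) Z"
  obtains e where "e \<in> carrier (global_sections X)"
    "restr X (topspace (top_of X)) Z e = \<one>\<^bsub>sect X Z\<^esub>"
    "restr X (topspace (top_of X)) (topspace (top_of X) - Z) e = \<zero>\<^bsub>sect X (topspace (top_of X) - Z)\<^esub>"
proof -
  let ?T = "topspace (top_of X)"
  define Z' where "Z' = ?T - Z"
  have Z': "openin (top_of X) Z'" using Z by (auto simp: Z'_def)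
  have ZZ: "Z \<inter> Z' = {}" "Z' \<inter> Z = {}" "Z \<union> Z' = ?T"
    using Z openin_subset[of "top_of X" Z] by (auto simp: Z'_def)
  interpret Z: cring "sect X Z" using cring_sect Z by blast
  interpret Z': cring "sect X Z'" using cring_sect Z' by blast
  define \<sigma> where "\<sigma> = (\<lambda>U. if U = Z then \<one>\<^bsub>sect X Z\<^esub> else \<zero>\<^bsub>sect X Z'\<^esub>)"
  have "\<exists>!t. t \<in> carrier (sect X (\<Union>{Z, Z'})) \<and> (\<forall>U\<in>{Z, Z'}. restr X (\<Union>{Z, Z'}) U t = \<sigma> U)"
  proof (rule glue)
    fix U assume U: "U \<in> {Z, Z'}"
    show "openin (top_of X) U" using U Z Z' by blast
    show car: "\<sigma> U \<in> carrier (sect X U)" using U by (auto simp: \<sigma>_def)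
  next
    fix U V assume UV: "U \<in> {Z, Z'}" "V \<in> {Z, Z'}"
    show "restr X U (U \<inter> V) (\<sigma> U) = restr X V (U \<inter> V) (\<sigma> V)"
    proof (cases "U = V")
      case False
      then have "U \<inter> V = {}" using UV ZZ by auto
      moreover have "restr X U {} (\<sigma> U) \<in> carrier (sect X {})" "restr X V {} (\<sigma> V) \<in> carrier (sect X {})"
        using UV Z Z' by (auto simp: \<sigma>_def intro!: restr_closed)
      ultimately show ?thesis using sect_empty by simp
    qed simp
  qed
  then obtain e where e: "e \<in> carrier (sect X ?T)" "restr X ?T Z e = \<sigma> Z" "restr X ?T Z' e = \<sigma> Z'"
    using ZZ(3) by auto
  \<comment> \<open>If \<open>Z'\<close> equals \<open>Z\<close>, both are empty and
    \<open>\<sigma>\<close> takes the value one there; over the empty set this is also zero.\<close>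
  have "\<sigma> Z' = \<zero>\<^bsub>sect X Z'\<^esub>"
  proof (cases "Z' = Z")
    case True
    then have "Z' = {}" using ZZ by blast
    then show ?thesis
      using sect_empty[of "\<one>\<^bsub>sect X {}\<^esub>" "\<zero>\<^bsub>sect X {}\<^esub>"] True Z.one_closed Z.zero_closed
      by (simp add: \<sigma>_def)
  qed (simp add: \<sigma>_def)
  then show thesis using that[of e] e by (simp add: Z'_def \<sigma>_def global_sections_def)
qed

end

section \<open>Idempotents in local rings\<close>

lemma local_ring_the_maximal_ideal: "local_ring R \<Longrightarrow> maximalideal (the_maximal_ideal R) R"
  unfolding local_ring_def the_maximal_ideal_def by (drule conjunct2) (rule theI')

text \<open>The element \<open>\<one> \<ominus> e\<close> is a unit, since otherwise the maximal
  ideal would contain it together with \<open>e\<close>, hence one. It annihilates \<open>e\<close>,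
  so \<open>e\<close> is zero.\<close>

lemma local_ring_idempotent:
  fixes R (structure)
  assumes "local_ring R" "e \<in> the_maximal_ideal R" "e \<otimes> e = e"
  shows "e = \<zero>"
proof -
  interpret cring R using assms(1) by (simp add: local_ring_def)
  interpret m: maximalideal "the_maximal_ideal R" R by (rule local_ring_the_maximal_ideal[OF assms(1)])
  have e: "e \<in> carrier R" using assms(2) by (rule m.Icarr)
  have "\<one> \<in> PIdl (\<one> \<ominus> e)"
  proof (rule ccontr)
    assume "\<one> \<notin> PIdl (\<one> \<ominus> e)"
    then obtain M where M: "maximalideal M R" "PIdl (\<one> \<ominus> e) \<subseteq> M"
      using exists_maximal_ideal[OF cgenideal_ideal] e by blast
    then have "M = the_maximal_ideal R"
      using assms(1) m.is_maximalideal unfolding local_ring_def by blast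
    then have "\<one> \<ominus> e \<in> the_maximal_ideal R" using M(2) cgenideal_self e by blast
    then have "(\<one> \<ominus> e) \<oplus> e \<in> the_maximal_ideal R" using assms(2) by (rule m.a_closed)
    moreover have "(\<one> \<ominus> e) \<oplus> e = \<one>" using e by algebra
    ultimately show False using m.one_imp_carrier m.I_notcarr by simp
  qed
  then obtain u where u: "u \<in> carrier R" "\<one> = u \<otimes> (\<one> \<ominus> e)" unfolding cgenideal_def by auto
  have "e = (u \<otimes> (\<one> \<ominus> e)) \<otimes> e" using u(2) e by simp
  also have "\<dots> = u \<otimes> (e \<ominus> e \<otimes> e)" using u(1) e by algebra
  also have "\<dots> = \<zero>" unfolding assms(3) using u(1) e by (simp add: minus_eq r_neg)
  finally show ?thesis .
qed

section \<open>Clopen sets under the canonical map\<close>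

context locally_ringed_space
begin

lemma canonical_map_prime:
  assumes x: "x \<in> topspace (top_of X)"
  shows "canonical_map X x \<in> primes (global_sections X)"
proof -
  interpret S: cring "stalk X x" using local_stalk[OF x] by (simp add: local_ring_def)
  interpret R: cring "global_sections X" by (rule cring_global_sections)
  interpret h: ring_hom_ring "global_sections X" "stalk X x" "germ X x (topspace (top_of X))"
    by (rule ring_hom_ringI2[OF R.ring_axioms S.ring_axioms germ_ring_hom[OF x]])
  show ?thesis
    unfolding primes_def canonical_map_def
    using h.primeideal_vimage[OF R.is_cring S.maximalideal_prime[OF local_ring_the_maximal_ideal[OF local_stalk[OF x]]]]
    by simp
qed

text \<open>Lying in the maximal ideal forces an idempotent germ to be zero, and a zero germ stays
  zero nearby. For a general section the vanishing locus is closed and need not be open.\<close>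

lemma idempotent_locally_zero:
  assumes x: "x \<in> topspace (top_of X)"
    and e: "e \<otimes>\<^bsub>global_sections X\<^esub> e = e" "e \<in> canonical_map X x"
  obtains W where "openin (top_of X) W" "x \<in> W" "restr X (topspace (top_of X)) W e = \<zero>\<^bsub>sect X W\<^esub>"
    "W \<subseteq> {y \<in> topspace (top_of X). e \<in> canonical_map X y}"
proof -
  let ?T = "topspace (top_of X)"
  interpret R: cring "global_sections X" by (rule cring_global_sections)
  have ecar: "e \<in> carrier (global_sections X)" using e(2) by (simp add: canonical_map_def)
  have ls: "(?T, s) \<in> local_sections X y" if "s \<in> carrier (global_sections X)" "y \<in> ?T" for s y
    using that by (simp add: local_sections_iff global_sections_def)
  have "germ X x ?T e \<otimes>\<^bsub>stalk X x\<^esub> germ X x ?T e = germ X x ?T e"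
    using ring_hom_mult[OF germ_ring_hom[OF x] ecar ecar] e(1) by simp
  then have "germ X x ?T e = \<zero>\<^bsub>stalk X x\<^esub>"
    using local_ring_idempotent[OF local_stalk[OF x]] e(2) by (simp add: canonical_map_def)
  then have "germ X x ?T e = germ X x ?T \<zero>\<^bsub>global_sections X\<^esub>" by (simp add: stalk_def)
  then obtain W where W: "openin (top_of X) W" "x \<in> W" "W \<subseteq> ?T"
    "restr X ?T W e = restr X ?T W \<zero>\<^bsub>global_sections X\<^esub>"
    using germ_eq_iff[OF ls[OF ecar x] ls[OF R.zero_closed x]] by auto
  interpret h: ring_hom_ring "global_sections X" "sect X W" "restr X ?T W"
    by (rule restr_ring_hom_ring[OF W(1)])
  have "restr X ?T W e = \<zero>\<^bsub>sect X W\<^esub>" using W(4) by simp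
  moreover have "e \<in> canonical_map X y" if y: "y \<in> W" for y
  proof -
    have yT: "y \<in> ?T" using y W(3) by blast
    interpret m: maximalideal "the_maximal_ideal (stalk X y)" "stalk X y"
      by (rule local_ring_the_maximal_ideal[OF local_stalk[OF yT]])
    have "germ X y ?T e = germ X y ?T \<zero>\<^bsub>global_sections X\<^esub>"
      using germ_eq_iff[OF ls[OF ecar yT] ls[OF R.zero_closed yT]] W y by auto
    also have "\<dots> = \<zero>\<^bsub>stalk X y\<^esub>" by (simp add: stalk_def)
    finally show ?thesis using ecar m.zero_closed by (simp add: canonical_map_def)
  qed
  ultimately show thesis using that W by blast
qed

lemma openin_idempotent_vanishing:
  assumes "e \<otimes>\<^bsub>global_sections X\<^esub> e = e"
  shows "openin (top_of X) {x \<in> topspace (top_of X). e \<in> canonical_map X x}"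
proof (subst openin_subopen, clarify)
  fix x assume x: "x \<in> topspace (top_of X)" "e \<in> canonical_map X x"
  show "\<exists>T. openin (top_of X) T \<and> x \<in> T \<and> T \<subseteq> {x \<in> topspace (top_of X). e \<in> canonical_map X x}"
    by (rule idempotent_locally_zero[OF x(1) assms x(2)]) blast
qed

lemma openin_vimage_clopen:
  assumes "openin (zariski_topology (global_sections X)) W" "closedin (zariski_topology (global_sections X)) W"
  shows "openin (top_of X) {x \<in> topspace (top_of X). canonical_map X x \<in> W}"
proof -
  interpret R: cring "global_sections X" by (rule cring_global_sections)
  \<comment> \<open>The idempotent is taken for the complement of \<open>W\<close>, so that the
    preimage of \<open>W\<close> is a vanishing locus, whose openness is known.\<close>
  obtain e where e: "e \<in> carrier (global_sections X)" "e \<otimes>\<^bsub>global_sections X\<^esub> e = e"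
    "primes (global_sections X) - W = basic_open (global_sections X) e"
    using R.clopen_zariski_idempotent[of "primes (global_sections X) - W"] assms
    by (metis closedin_def openin_closedin_eq topspace_zariski_topology)
  have "{x \<in> topspace (top_of X). canonical_map X x \<in> W} =
      {x \<in> topspace (top_of X). e \<in> canonical_map X x}"
    using e(3) canonical_map_prime openin_subset[OF assms(1)]
    by (auto simp: basic_open_def topspace_zariski_topology)
  then show ?thesis using openin_idempotent_vanishing[OF e(2)] by simp
qed

text \<open>If no point maps into the locus of \<open>e\<close>, then \<open>e\<close> lies in the
  maximal ideal at every point, so it is locally zero and hence zero. But zero lies in every prime,
  so its locus is empty.\<close>

lemma vimage_clopen_nonempty:
  assumes W: "openin (zariski_topology (global_sections X)) W"
    "closedin (zariski_topology (global_sections X)) W" "W \<noteq> {}"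
  shows "\<exists>x\<in>topspace (top_of X). canonical_map X x \<in> W"
proof (rule ccontr)
  assume contr: "\<not> (\<exists>x\<in>topspace (top_of X). canonical_map X x \<in> W)"
  let ?T = "topspace (top_of X)"
  interpret R: cring "global_sections X" by (rule cring_global_sections)
  obtain e where e: "e \<in> carrier (global_sections X)" "e \<otimes>\<^bsub>global_sections X\<^esub> e = e"
    "W = basic_open (global_sections X) e"
    using R.clopen_zariski_idempotent[OF W(1,2)] by blast
  have "e = \<zero>\<^bsub>global_sections X\<^esub>"
  proof (rule global_section_eqI[OF e(1) R.zero_closed])
    fix x assume x: "x \<in> ?T"
    have "e \<in> canonical_map X x"
      using contr x canonical_map_prime[OF x] e(3) by (auto simp: basic_open_def)
    then obtain U where U: "openin (top_of X) U" "x \<in> U" "restr X ?T U e = \<zero>\<^bsub>sect X U\<^esub>"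
      using idempotent_locally_zero[OF x e(2)] by metis
    interpret h: ring_hom_ring "global_sections X" "sect X U" "restr X ?T U"
      by (rule restr_ring_hom_ring[OF U(1)])
    show "\<exists>U. openin (top_of X) U \<and> x \<in> U \<and> restr X ?T U e = restr X ?T U \<zero>\<^bsub>global_sections X\<^esub>"
      using U by (intro exI[of _ U]) simp
  qed
  moreover obtain p where "p \<in> W" using W(3) by blast
  then have "e \<notin> p" "primeideal p (global_sections X)" using e(3) by (auto simp: basic_open_def primes_def)
  ultimately show False
    by (simp add: additive_subgroup.zero_closed ideal.axioms(1) primeideal.axioms(1))
qed

lemma clopen_is_vimage:
  assumes Z: "openin (top_of X) Z" "closedin (top_of X) Z"
  shows "\<exists>W. openin (zariski_topology (global_sections X)) W \<and>
    closedin (zariski_topology (global_sections X)) W \<and>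
    Z = {x \<in> topspace (top_of X). canonical_map X x \<in> W}"
proof -
  let ?T = "topspace (top_of X)" and ?R = "global_sections X"
  interpret R: cring ?R by (rule cring_global_sections)
  obtain e where e: "e \<in> carrier ?R" "restr X ?T Z e = \<one>\<^bsub>sect X Z\<^esub>"
    "restr X ?T (?T - Z) e = \<zero>\<^bsub>sect X (?T - Z)\<^esub>"
    using clopen_indicator_section[OF Z] .
  have Z': "openin (top_of X) (?T - Z)" using Z(2) by (simp add: closedin_def)
  interpret Z: ring_hom_ring ?R "sect X Z" "restr X ?T Z" by (rule restr_ring_hom_ring[OF Z(1)])
  interpret Z': ring_hom_ring ?R "sect X (?T - Z)" "restr X ?T (?T - Z)" by (rule restr_ring_hom_ring[OF Z'])
  \<comment> \<open>Idempotence can be checked on \<open>Z\<close> and on its complement, where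
    \<open>e\<close> restricts to one and to zero.\<close>
  have idem: "e \<otimes>\<^bsub>?R\<^esub> e = e"
  proof (rule global_section_eqI)
    fix x assume x: "x \<in> ?T"
    show "\<exists>W. openin (top_of X) W \<and> x \<in> W \<and> restr X ?T W (e \<otimes>\<^bsub>?R\<^esub> e) = restr X ?T W e"
    proof (cases "x \<in> Z")
      case True
      then show ?thesis using Z(1) e by (intro exI[of _ Z]) simp
    next
      case False
      then show ?thesis using Z' x e by (intro exI[of _ "?T - Z"]) simp
    qed
  qed (use e(1) in auto)
  have ls: "(?T, s) \<in> local_sections X y" if "s \<in> carrier ?R" "y \<in> ?T" for s y
    using that by (simp add: local_sections_iff global_sections_def)
  have "e \<notin> canonical_map X x \<longleftrightarrow> x \<in> Z" if x: "x \<in> ?T" for x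
  proof -
    interpret p: primeideal "canonical_map X x" ?R using canonical_map_prime[OF x] by (simp add: primes_def)
    show ?thesis
    proof (cases "x \<in> Z")
      case True
      have "germ X x ?T e = germ X x ?T \<one>\<^bsub>?R\<^esub>"
        unfolding germ_eq_iff[OF ls[OF e(1) x] ls[OF R.one_closed x]]
        using True Z(1) e(2) openin_subset[OF Z(1)] by (intro exI[of _ Z]) simp
      then have "e \<in> canonical_map X x \<longleftrightarrow> \<one>\<^bsub>?R\<^esub> \<in> canonical_map X x"
        by (simp only: canonical_map_def mem_Collect_eq e(1) R.one_closed)
      then show ?thesis using True p.one_imp_carrier p.I_notcarr by auto
    next
      case False
      have "germ X x ?T e = germ X x ?T \<zero>\<^bsub>?R\<^esub>"
        unfolding germ_eq_iff[OF ls[OF e(1) x] ls[OF R.zero_closed x]]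
        using False Z' e(3) x by (intro exI[of _ "?T - Z"]) simp
      then have "e \<in> canonical_map X x \<longleftrightarrow> \<zero>\<^bsub>?R\<^esub> \<in> canonical_map X x"
        by (simp only: canonical_map_def mem_Collect_eq e(1) R.zero_closed)
      then show ?thesis using False p.zero_closed by auto
    qed
  qed
  then have "Z = {x \<in> ?T. canonical_map X x \<in> basic_open ?R e}"
    using canonical_map_prime openin_subset[OF Z(1)] by (auto simp: basic_open_def)
  then show ?thesis
    using openin_basic_open[OF e(1)] R.closedin_basic_open_idempotent[OF e(1) idem]
    by (intro exI[of _ "basic_open ?R e"] conjI)
qed

end

text \<open>Here local affineness enters: inside an affine open neighbourhood \<open>V\<close> of
  \<open>x\<close>, a basic open set of the spectrum within the image of \<open>U \<inter> V\<close>
  is pulled back. It is compact there, and it stays open in \<open>X\<close> because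
  \<open>V\<close> is open.\<close>

lemma (in scheme) compact_open_base:
  assumes U: "openin (top_of X) U" "x \<in> U"
  shows "\<exists>K. openin (top_of X) K \<and> compactin (top_of X) K \<and> x \<in> K \<and> K \<subseteq> U"
proof -
  have "x \<in> topspace (top_of X)" using U openin_subset by blast
  then obtain V and A :: "'b ring" and \<phi> \<psi> where V: "openin (top_of X) V" "x \<in> V" "cring A"
    and iso: "ringed_space_iso (open_subspace X V) (Spec A) \<phi> \<psi>"
    using locally_affine by blast
  interpret A: cring A by (rule V(3))
  let ?S = "subtopology (top_of X) V"
  have hom: "homeomorphic_map ?S (zariski_topology A) \<phi>"
    using iso by (simp add: ringed_space_iso_def open_subspace_def Spec_def Let_def)
  have VT: "topspace ?S = V" using openin_subset[OF V(1)] by auto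
  have UV: "openin ?S (U \<inter> V)" using U(1) by (auto simp: openin_subtopology)
  then have "openin (zariski_topology A) (\<phi> ` (U \<inter> V))"
    using homeomorphic_map_openness[OF hom, of "U \<inter> V"] VT by auto
  moreover have "\<phi> x \<in> \<phi> ` (U \<inter> V)" using U(2) V(2) by blast
  ultimately obtain f where f: "f \<in> carrier A" "\<phi> x \<in> basic_open A f" "basic_open A f \<subseteq> \<phi> ` (U \<inter> V)"
    by (rule zariski_base)
  define K where "K = {y \<in> U \<inter> V. \<phi> y \<in> basic_open A f}"
  have img: "\<phi> ` K = basic_open A f" using f(3) by (auto simp: K_def)
  have KV: "K \<subseteq> topspace ?S" using VT by (auto simp: K_def)
  have "openin ?S K" "compactin ?S K"
    using homeomorphic_map_openness[OF hom KV] homeomorphic_map_compactness[OF hom KV] img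
      openin_basic_open[OF f(1)] A.compactin_basic_open[OF f(1)] by simp_all
  then show ?thesis
    using U(2) V f(2) by (intro exI[of _ K]) (auto simp: K_def compactin_subtopology openin_open_subtopology)
qed

theorem theorem1p2:
  fixes X :: "('a, 'b) ringed_space_data"
  assumes "scheme X" and "quasi_compact X" and "quasi_separated X"
  shows "connected_components_of (top_of X) =
      (\<lambda>C. {x \<in> topspace (top_of X). canonical_map X x \<in> C}) `
        connected_components_of (top_of (Spec (global_sections X))) \<and>
    (\<exists>g. homeomorphic_map (pi0 (top_of X)) (pi0 (top_of (Spec (global_sections X)))) g \<and>
      (\<forall>x\<in>topspace (top_of X). g (connected_component_of_set (top_of X) x) =
        connected_component_of_set (top_of (Spec (global_sections X))) (canonical_map X x)))"
proof -
  interpret scheme X by (rule assms(1))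
  interpret R: cring "global_sections X" by (rule cring_global_sections)
  have top: "top_of (Spec (global_sections X)) = zariski_topology (global_sections X)"
    by (simp add: Spec_def)
  interpret clopen_correspondence "top_of X" "zariski_topology (global_sections X)" "canonical_map X"
  proof
    show "compact_space (top_of X)" using assms(2) by (simp add: quasi_compact_def)
    \<comment> \<open>Quasi-separatedness provides the compact intersections, and affine
      neighbourhoods provide the base.\<close>
    then show "quasi_component_of (top_of X) x = connected_component_of (top_of X) x" for x
      using assms(3) compact_open_base
      by (intro quasi_eq_connected_component_of_compact_base) (auto simp: quasi_separated_def)
  qed (simp_all add: R.compact_space_zariski R.quasi_eq_connected_component_of_zariski
      topspace_zariski_topology canonical_map_prime openin_vimage_clopen vimage_clopen_nonempty
      clopen_is_vimage)
  obtain g where "homeomorphic_map (pi0 (top_of X)) (pi0 (zariski_topology (global_sections X))) g"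
    "\<And>x. x \<in> topspace (top_of X) \<Longrightarrow> g (connected_component_of_set (top_of X) x) =
      connected_component_of_set (zariski_topology (global_sections X)) (canonical_map X x)"
    by (rule pi0_homeomorphism) (rule that)
  then show ?thesis unfolding top using components_dom by blast
qed

end
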